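(* Let $Q=\prod_{j=1}^n(a_j,b_j)\subset\mathbb R^n$ with $a_j<b_j$, let $p=(p_1,\ldots,p_n)\in Q$, and put $q_j=(p_j-a_j)/(b_j-a_j)$. Suppose $F=(f_1,\ldots,f_n):\mathbb D\to Q$ is harmonic, $F(0)=p$, and $\|dF_0\|=M_Q(p)$. Let $U_j$ be the radial boundary values of $f_j$. Then, up to null sets, the functions $$\frac{U_j-a_j}{b_j-a_j},\qquad j=1,\ldots,n,$$ are characteristic functions of arcs of $\mathbb T$ of angular lengths $2\pi q_j$, and the centers of all these arcs determine the same unoriented line through the origin in $\mathbb R^2$ (that is, any two centers are equal or antipodal on $\mathbb T$). Conversely, every such choice gives equality: if $U_j=a_j+(b_j-a_j)\chi_{I_j}$ with $I_j\subset\mathbb T$ arcs of angular lengths $2\pi q_j$ whose centers all lie on one line through the origin, then the map $F$ whose components are the Poisson integrals of the $U_j$ is a harmonic map $\mathbb D\to Q$ with $F(0)=p$ and $\|dF_0\|=M_Q(p)$.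
   Context: $\mathbb D=\{z\in\mathbb C:|z|<1\}$, $\mathbb T=\partial\mathbb D$. A map into $\mathbb R^n$ is harmonic if each component is. $\|dF_0\|$ is the operator norm of the real differential $dF_0:\mathbb R^2\to\mathbb R^n$ with respect to the Euclidean norms. A bounded harmonic function on $\mathbb D$ has radial boundary values almost everywhere on $\mathbb T$ and is the Poisson integral of them. For $p\in Q$, $$M_Q(p)=\left(\sum_{j=1}^n A_j(p_j)^2\right)^{1/2},\qquad A_j(p_j)=\frac{2(b_j-a_j)}{\pi}\sin\frac{\pi(p_j-a_j)}{b_j-a_j}.$$ The number $M_Q(p)$ is an upper bound for $\|dF_0\|$ over harmonic $F:\mathbb D\to Q$ with $F(0)=p$. *)

theory Defs
  imports "HOL-Analysis.Analysis"
begin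

abbreviation unit_disc :: "complex set" where
  "unit_disc \<equiv> ball 0 1"

abbreviation unit_circle :: "complex set" where
  "unit_circle \<equiv> sphere 0 1"

text \<open>Twice continuously differentiable with vanishing Laplacian. Since \<open>S\<close> is open, the
  witnesses are the first and second order partial derivatives of \<open>f\<close>.\<close>

definition harmonic_on :: "(complex \<Rightarrow> real) \<Rightarrow> complex set \<Rightarrow> bool" where
  "harmonic_on f S \<longleftrightarrow> open S \<and>
     (\<exists>fx fy fxx fxy fyx fyy.
        continuous_on S fxx \<and> continuous_on S fxy \<and> continuous_on S fyx \<and> continuous_on S fyy \<and>
        (\<forall>z\<in>S.
          (f has_derivative (\<lambda>h. fx z * Re h + fy z * Im h)) (at z) \<and>
          (fx has_derivative (\<lambda>h. fxx z * Re h + fxy z * Im h)) (at z) \<and>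
          (fy has_derivative (\<lambda>h. fyx z * Re h + fyy z * Im h)) (at z) \<and>
          fxx z + fyy z = 0))"

definition harmonic_map_on :: "(complex \<Rightarrow> real ^ 'n) \<Rightarrow> complex set \<Rightarrow> bool" where
  "harmonic_map_on F S \<longleftrightarrow> (\<forall>j. harmonic_on (\<lambda>z. F z $ j) S)"

text \<open>Arc length on the unit circle, of total mass \<open>2 * pi\<close>. The underlying space is the circle
  itself, so functions are integrated without regard to their values off the circle.\<close>

definition arc_length_measure :: "complex measure" where
  "arc_length_measure =
     distr (restrict_space lborel {0..<2 * pi}) (restrict_space borel unit_circle) cis"

definition radial_boundary_values :: "(complex \<Rightarrow> real) \<Rightarrow> (complex \<Rightarrow> real) \<Rightarrow> bool" where
  "radial_boundary_values f U \<longleftrightarrow>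
     (AE \<zeta> in arc_length_measure. ((\<lambda>r. f (of_real r * \<zeta>)) \<longlongrightarrow> U \<zeta>) (at_left 1))"

definition poisson_integral :: "(complex \<Rightarrow> real) \<Rightarrow> complex \<Rightarrow> real" where
  "poisson_integral U z =
     1 / (2 * pi) * (\<integral>\<zeta>. (1 - (norm z)\<^sup>2) / (norm (\<zeta> - z))\<^sup>2 * U \<zeta> \<partial>arc_length_measure)"

text \<open>\<open>I\<close> is an arc of angular length \<open>L\<close> centred at the point \<open>c\<close> of the circle; each of the
  two end points may or may not belong to \<open>I\<close>.\<close>

definition is_circle_arc :: "complex set \<Rightarrow> complex \<Rightarrow> real \<Rightarrow> bool" where
  "is_circle_arc I c L \<longleftrightarrow> 0 < L \<and> L < 2 * pi \<and>
     (\<exists>\<theta>. c = cis \<theta> \<and> cis ` {\<theta> - L / 2 <..< \<theta> + L / 2} \<subseteq> I \<and> I \<subseteq> cis ` {\<theta> - L / 2 .. \<theta> + L / 2})"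

definition A_coef :: "real \<Rightarrow> real \<Rightarrow> real \<Rightarrow> real" where
  "A_coef \<alpha> \<beta> x = 2 * (\<beta> - \<alpha>) / pi * sin (pi * (x - \<alpha>) / (\<beta> - \<alpha>))"

text \<open>The bound \<open>M\<^sub>Q(p)\<close> for the open box \<open>Q = box a b\<close>.\<close>

definition M_box :: "real ^ 'n \<Rightarrow> real ^ 'n \<Rightarrow> real ^ 'n \<Rightarrow> real" where
  "M_box a b p = sqrt (\<Sum>j\<in>UNIV. (A_coef (a $ j) (b $ j) (p $ j))\<^sup>2)"

end

theory Submission
  imports Defs "HOL-Complex_Analysis.Cauchy_Integral_Formula"
begin

text \<open>Letting \<open>r\<close> tend to \<open>1\<close> in Cauchy's formulas on \<open>|z| = r\<close>, the value and the gradient of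
  \<open>f\<^sub>j\<close> at \<open>0\<close> become the zeroth and first Fourier coefficients of its boundary values \<open>U\<^sub>j\<close>.
  Among functions \<open>0 \<le> V \<le> 1\<close> of mass \<open>2 \<pi> q\<close> the integral of \<open>V\<close> against the coordinate in
  direction \<open>e\<close> is largest exactly for the arc of length \<open>2 \<pi> q\<close> centred at \<open>e\<close>. If \<open>e\<close> is a unit
  vector at which the operator norm of \<open>dF\<^sub>0\<close> is attained, equality forces every component to be
  extremal in direction \<open>e\<close> or \<open>-e\<close>, so all centres are \<open>\<plusminus>e\<close>. Conversely, the Poisson integral
  of an arc is the real part of an explicit combination of two logarithms, from which its values
  and its gradient at \<open>0\<close> are read off.\<close>

text \<open>One direction serves all components because the bound splits: along every unit vector
  the derivative of the component \<open>j\<close> is at most \<open>A_j(p_j)\<close> in absolute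
  value, and \<open>M_Q(p)\<close> squared is the sum of the squares of these bounds. Equality at
  \<open>e\<close> leaves no slack in any summand and frees only the sign of each derivative; these
  signs are the choice between equal and antipodal centers. The constant \<open>A_j\<close> is a
  product of three contributions: \<open>1 / pi\<close> from the Fourier coefficient,
  \<open>2 * sin (pi * q)\<close> from the first moment of the arc, and \<open>b_j - a_j\<close>
  from rescaling the unit interval. Three obstacles shape the proof. Harmonicity is given through
  real second order partials, so a holomorphic function with real part \<open>f_j\<close> has to be
  built before Cauchy's formulas apply. The boundary values are known only as radial limits almost
  everywhere, so integrals are taken of a measurable representative. Arcs may cross the angle 0 and
  their end points are unspecified, so the period of integration must be movable and finite sets
  negligible.\<close>

section \<open>Arc length on the circle, read in the angle\<close>

lemma space_arc_length_measure [simp]: "space arc_length_measure = unit_circle"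
  by (simp add: arc_length_measure_def space_restrict_space)

lemma sets_arc_length_measure [measurable_cong]:
  "sets arc_length_measure = sets (restrict_space borel unit_circle)"
  by (simp add: arc_length_measure_def)

lemma cis_measurable_circle:
  "cis \<in> measurable (restrict_space lborel S) (restrict_space borel unit_circle)"
proof (rule measurable_restrict_space2)
  have "cis \<in> borel_measurable borel"
    by (intro borel_measurable_continuous_onI continuous_intros)
  then show "cis \<in> restrict_space lborel S \<rightarrow>\<^sub>M borel"
    by (intro measurable_restrict_space1) simp
qed auto

lemma emeasure_periodic_translate:
  fixes c :: real
  assumes "E \<in> sets borel" and per: "\<And>t. t + c \<in> E \<longleftrightarrow> t \<in> E"
  shows "emeasure lborel (E \<inter> {s + c..<t + c}) = emeasure lborel (E \<inter> {s..<t})"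
proof -
  have "emeasure lborel (E \<inter> {s + c..<t + c})
      = emeasure (distr lborel borel ((+) c)) (E \<inter> {s + c..<t + c})"
    by (simp only: lborel_distr_plus)
  also have "\<dots> = emeasure lborel ((+) c -` (E \<inter> {s + c..<t + c}))"
    using assms by (subst emeasure_distr) auto
  also have "(+) c -` (E \<inter> {s + c..<t + c}) = E \<inter> {s..<t}"
  proof -
    have "c + t \<in> E \<longleftrightarrow> t \<in> E" for t
      using per[of t] by (simp only: add.commute)
    then show ?thesis by auto
  qed
  finally show ?thesis .
qed

text \<open>Cut the window at the multiple \<open>m\<close> of \<open>P\<close> that lies in it and
  move the piece left of \<open>m\<close> up by one period. The two pieces then fill
  \<open>{m..<m + P}\<close>, which is \<open>{0..<P}\<close> moved by a whole number of
  periods.\<close>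

lemma emeasure_periodic_period:
  fixes P :: real
  assumes E: "E \<in> sets borel" and per: "\<And>t. t + P \<in> E \<longleftrightarrow> t \<in> E" and P: "P > 0"
  shows "emeasure lborel (E \<inter> {s..<s + P}) = emeasure lborel (E \<inter> {0..<P})"
proof -
  define k where "k = \<lceil>s / P\<rceil>"
  define m where "m = of_int k * P"
  have "s / P \<le> of_int k" "of_int k < s / P + 1"
    unfolding k_def by linarith+
  then have m: "s \<le> m" "m \<le> s + P"
    using P by (auto simp: m_def field_simps)
  have perk: "t + of_int j * P \<in> E \<longleftrightarrow> t \<in> E" for t j
  proof (induction j arbitrary: t rule: int_induct[where k = 0])
    case (step1 i)
    have "t + of_int (i + 1) * P = (t + of_int i * P) + P" by (simp add: algebra_simps)
    then show ?case using step1 per by metis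
  next
    case (step2 i)
    have "t + of_int i * P = (t + of_int (i - 1) * P) + P" by (simp add: algebra_simps)
    then show ?case using step2 per by metis
  qed simp
  have [measurable]: "E \<in> sets borel" by fact
  have "E \<inter> {s..<s + P} = (E \<inter> {s..<m}) \<union> (E \<inter> {m..<s + P})"
    using m by auto
  then have "emeasure lborel (E \<inter> {s..<s + P})
      = emeasure lborel (E \<inter> {s..<m}) + emeasure lborel (E \<inter> {m..<s + P})"
    by (subst plus_emeasure) (auto simp: E)
  also have "emeasure lborel (E \<inter> {s..<m}) = emeasure lborel (E \<inter> {s + P..<m + P})"
    using emeasure_periodic_translate[OF E per] by simp
  also have "emeasure lborel (E \<inter> {s + P..<m + P}) + emeasure lborel (E \<inter> {m..<s + P})
      = emeasure lborel ((E \<inter> {s + P..<m + P}) \<union> (E \<inter> {m..<s + P}))"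
    by (subst plus_emeasure) (auto simp: E)
  also have "(E \<inter> {s + P..<m + P}) \<union> (E \<inter> {m..<s + P}) = E \<inter> {0 + of_int k * P..<P + of_int k * P}"
    using m by (auto simp: m_def)
  also have "emeasure lborel \<dots> = emeasure lborel (E \<inter> {0..<P})"
    by (rule emeasure_periodic_translate[OF E perk])
  finally show ?thesis .
qed

text \<open>The window \<open>{0..<2 * pi}\<close> splits every arc that crosses the point 1.
  Preimages under \<open>cis\<close> are periodic, so the window may start at whatever angle suits
  the arc.\<close>

lemma arc_length_measure_shift:
  "arc_length_measure
     = distr (restrict_space lborel {s..<s + 2 * pi}) (restrict_space borel unit_circle) cis"
proof (rule measure_eqI)
  show "sets arc_length_measure =
      sets (distr (restrict_space lborel {s..<s + 2 * pi}) (restrict_space borel unit_circle) cis)"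
    by (simp add: arc_length_measure_def)
  fix A assume "A \<in> sets arc_length_measure"
  then have A: "A \<in> sets (restrict_space borel unit_circle)"
    by (simp add: arc_length_measure_def)
  then have Ab: "A \<in> sets borel"
    by (auto simp: sets_restrict_space)
  define E where "E = cis -` A"
  have cm: "cis \<in> borel_measurable borel"
    by (intro borel_measurable_continuous_onI continuous_intros)
  have E: "E \<in> sets borel"
    using measurable_sets[OF cm Ab] by (simp add: E_def)
  have per: "t + 2 * pi \<in> E \<longleftrightarrow> t \<in> E" for t
    by (simp add: E_def cis.ctr)
  have em: "emeasure (distr (restrict_space lborel {u..<u + 2 * pi}) (restrict_space borel unit_circle) cis) A
      = emeasure lborel (E \<inter> {u..<u + 2 * pi})" for u
    using A by (simp add: emeasure_distr cis_measurable_circle space_restrict_space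
        emeasure_restrict_space E_def)
  show "emeasure arc_length_measure A =
      emeasure (distr (restrict_space lborel {s..<s + 2 * pi}) (restrict_space borel unit_circle) cis) A"
    unfolding em using em[of 0] emeasure_periodic_period[OF E per]
    by (simp add: arc_length_measure_def)
qed

lemma finite_measure_arc_length: "finite_measure arc_length_measure"
proof
  have "unit_circle \<in> sets (restrict_space borel unit_circle)"
    using sets.top[of "restrict_space borel unit_circle"] by (simp add: space_restrict_space)
  moreover have "cis -` unit_circle = UNIV" by auto
  ultimately show "emeasure arc_length_measure (space arc_length_measure) \<noteq> \<infinity>"
    by (simp add: arc_length_measure_def emeasure_distr cis_measurable_circle
        space_restrict_space emeasure_restrict_space)
qed

lemma AE_arc_length_iff:
  assumes "{\<zeta>\<in>unit_circle. P \<zeta>} \<in> sets (restrict_space borel unit_circle)"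
  shows "(AE \<zeta> in arc_length_measure. P \<zeta>) \<longleftrightarrow> (AE t in lborel. t \<in> {s..<s + 2 * pi} \<longrightarrow> P (cis t))"
  using assms unfolding arc_length_measure_shift[of s]
  by (subst AE_distr_iff[OF cis_measurable_circle])
     (simp_all add: AE_restrict_space_iff space_restrict_space)

lemma integral_arc_length:
  fixes h :: "complex \<Rightarrow> 'b :: {banach, second_countable_topology}"
  assumes "h \<in> borel_measurable arc_length_measure"
  shows "integral\<^sup>L arc_length_measure h = (\<integral>t. indicator {s..<s + 2 * pi} t *\<^sub>R h (cis t) \<partial>lborel)"
proof -
  have "h \<in> borel_measurable (restrict_space borel unit_circle)"
    using assms by (simp cong: measurable_cong_sets add: sets_arc_length_measure)
  then show ?thesis
    unfolding arc_length_measure_shift[of s]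
    by (subst integral_distr[OF cis_measurable_circle]) (simp_all add: integral_restrict_space)
qed

lemma continuous_on_circle_measurable:
  "continuous_on unit_circle h \<Longrightarrow> h \<in> borel_measurable arc_length_measure"
  using borel_measurable_continuous_on_restrict[of unit_circle h]
  by (simp cong: measurable_cong_sets add: sets_arc_length_measure)

lemma integrable_arc_length_bounded:
  fixes h :: "complex \<Rightarrow> 'b :: {banach, second_countable_topology}"
  assumes "h \<in> borel_measurable arc_length_measure" and "AE \<zeta> in arc_length_measure. norm (h \<zeta>) \<le> B"
  shows "integrable arc_length_measure h"
  using finite_measure.integrable_const_bound[OF finite_measure_arc_length] assms by blast

lemma integrable_arc_length_continuous:
  fixes h :: "complex \<Rightarrow> 'b :: {banach, second_countable_topology}"
  assumes "continuous_on unit_circle h"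
  shows "integrable arc_length_measure h"
proof -
  have "bounded (h ` unit_circle)"
    by (intro compact_imp_bounded compact_continuous_image assms) auto
  then obtain B where "\<forall>x\<in>unit_circle. norm (h x) \<le> B"
    unfolding bounded_iff by blast
  then show ?thesis
    by (intro integrable_arc_length_bounded[where B = B] continuous_on_circle_measurable assms AE_I2) simp
qed

text \<open>The bridge to contour integrals, which unfold to gauge integrals over the closed
  interval; the additional end point \<open>2 * pi\<close> is a null set.\<close>

lemma has_integral_arc_length:
  fixes h :: "complex \<Rightarrow> 'b :: euclidean_space"
  assumes "continuous_on unit_circle h"
  shows "((\<lambda>t. h (cis t)) has_integral integral\<^sup>L arc_length_measure h) {0..2 * pi}"
proof -
  have c: "continuous_on {0..2 * pi} (\<lambda>t. h (cis t))"
    by (intro continuous_on_compose2[OF assms] continuous_intros) auto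
  have "set_integrable lborel {0..2 * pi} (\<lambda>t. h (cis t))"
    by (rule borel_integrable_atLeastAtMost'[OF c])
  note * = set_borel_integral_eq_integral[OF this]
  have "integral\<^sup>L arc_length_measure h = (\<integral>t. indicator {0..<0 + 2 * pi} t *\<^sub>R h (cis t) \<partial>lborel)"
    by (rule integral_arc_length[OF continuous_on_circle_measurable[OF assms]])
  also have "\<dots> = (LBINT t:{0..2 * pi}. h (cis t))"
    unfolding set_lebesgue_integral_def
  proof (rule integral_cong_AE)
    have m: "(\<lambda>t. h (cis t)) \<in> borel_measurable borel"
      by (intro borel_measurable_continuous_onI continuous_on_compose2[OF assms] continuous_intros) auto
    show "(\<lambda>t. indicat_real {0..<0 + 2 * pi} t *\<^sub>R h (cis t)) \<in> borel_measurable lborel"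
      "(\<lambda>t. indicat_real {0..2 * pi} t *\<^sub>R h (cis t)) \<in> borel_measurable lborel"
      using m by auto
    show "AE t in lborel. indicat_real {0..<0 + 2 * pi} t *\<^sub>R h (cis t)
        = indicat_real {0..2 * pi} t *\<^sub>R h (cis t)"
      using AE_lborel_singleton[of "2 * pi"] by eventually_elim (auto simp: indicator_def)
  qed
  finally show ?thesis
    using * by (simp add: has_integral_iff)
qed

section \<open>Arcs and the fundamental theorem of calculus on them\<close>

lemma cis_inj_on_period:
  assumes "cis s = cis t" "\<bar>s - t\<bar> < 2 * pi"
  shows "s = t"
proof -
  have "sin s = sin t" "cos s = cos t"
    using assms(1) by (auto simp: complex_eq_iff)
  then obtain n :: int where n: "s = t + 2 * pi * of_int n"
    using sin_cos_eq_iff[of s t] by auto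
  then have "\<bar>of_int n * (2 * pi)\<bar> < 2 * pi"
    using assms(2) by (simp add: mult.commute)
  then have "\<bar>real_of_int n\<bar> < 1"
    by (simp add: abs_mult)
  then have "n = 0" by linarith
  with n show ?thesis by simp
qed

lemma arc_borel:
  assumes "cis ` {\<alpha><..<\<beta>} \<subseteq> I" "I \<subseteq> cis ` {\<alpha>..\<beta>}"
  shows "I \<in> sets (restrict_space borel unit_circle)"
proof -
  have "compact (cis ` {\<alpha>..\<beta>})"
    by (intro compact_continuous_image continuous_intros) auto
  then have "cis ` {\<alpha>..\<beta>} \<in> sets borel"
    by (simp add: borel_compact)
  moreover have "finite (cis ` {\<alpha>..\<beta>} - I)"
  proof (rule finite_subset)
    show "cis ` {\<alpha>..\<beta>} - I \<subseteq> {cis \<alpha>, cis \<beta>}"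
    proof
      fix z assume z: "z \<in> cis ` {\<alpha>..\<beta>} - I"
      then obtain t where t: "z = cis t" "\<alpha> \<le> t" "t \<le> \<beta>" by auto
      with z assms(1) have "t \<notin> {\<alpha><..<\<beta>}" by blast
      with t show "z \<in> {cis \<alpha>, cis \<beta>}" by (cases "t = \<alpha>") auto
    qed
  qed auto
  ultimately have "cis ` {\<alpha>..\<beta>} - (cis ` {\<alpha>..\<beta>} - I) \<in> sets borel"
    by (intro sets.Diff borel_closed[OF finite_imp_closed[of "cis ` {\<alpha>..\<beta>} - I"]]) simp_all
  also have "cis ` {\<alpha>..\<beta>} - (cis ` {\<alpha>..\<beta>} - I) = I"
    using assms by blast
  finally have "I \<in> sets borel" .
  moreover have "I \<subseteq> unit_circle"
    using assms(2) by auto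
  ultimately show ?thesis
    by (auto simp: sets_restrict_space)
qed

text \<open>With the period started at \<open>\<alpha>\<close> the arc becomes a single interval of
  angles, up to the two end points, and the integral telescopes.\<close>

lemma integral_arc_FTC:
  fixes h :: "complex \<Rightarrow> real" and F :: "real \<Rightarrow> real"
  assumes I: "cis ` {\<alpha><..<\<beta>} \<subseteq> I" "I \<subseteq> cis ` {\<alpha>..\<beta>}"
    and le: "\<alpha> \<le> \<beta>" "\<beta> \<le> \<alpha> + 2 * pi"
    and h: "continuous_on unit_circle h"
    and F: "\<And>t. (F has_real_derivative h (cis t)) (at t)"
  shows "(\<integral>\<zeta>. h \<zeta> * indicator I \<zeta> \<partial>arc_length_measure) = F \<beta> - F \<alpha>"
proof -
  have mI [measurable]: "(indicator I :: complex \<Rightarrow> real) \<in> borel_measurable arc_length_measure"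
    by (rule borel_measurable_indicator) (simp add: sets_arc_length_measure arc_borel[OF I])
  have mh [measurable]: "h \<in> borel_measurable arc_length_measure"
    by (rule continuous_on_circle_measurable[OF h])
  have m: "(\<lambda>\<zeta>. h \<zeta> * indicator I \<zeta>) \<in> borel_measurable arc_length_measure"
    by measurable
  have ch: "continuous_on UNIV (\<lambda>t. h (cis t))"
    by (intro continuous_on_compose2[OF h] continuous_intros) auto
  have Ib: "I \<in> sets borel"
    using arc_borel[OF I] by (auto simp: sets_restrict_space)
  have [measurable]: "(\<lambda>t. h (cis t)) \<in> borel_measurable borel" "cis \<in> borel_measurable borel"
    by (intro borel_measurable_continuous_onI ch continuous_intros)+
  have [measurable]: "(\<lambda>t. indicat_real I (cis t)) \<in> borel_measurable borel"
    by (rule measurable_compose[OF _ borel_measurable_indicator[OF Ib]]) measurable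
  have "(\<integral>\<zeta>. h \<zeta> * indicator I \<zeta> \<partial>arc_length_measure)
      = (\<integral>t. indicator {\<alpha>..<\<alpha> + 2 * pi} t *\<^sub>R (h (cis t) * indicator I (cis t)) \<partial>lborel)"
    by (rule integral_arc_length[OF m])
  also have "\<dots> = (\<integral>t. indicator {\<alpha>..\<beta>} t *\<^sub>R h (cis t) \<partial>lborel)"
  proof (rule integral_cong_AE)
    show "AE t in lborel. indicat_real {\<alpha>..<\<alpha> + 2 * pi} t *\<^sub>R (h (cis t) * indicat_real I (cis t))
        = indicat_real {\<alpha>..\<beta>} t *\<^sub>R h (cis t)"
      using AE_lborel_singleton[of \<alpha>] AE_lborel_singleton[of \<beta>]
    proof eventually_elim
      case (elim t)
      have "cis t \<in> I \<longleftrightarrow> t \<in> {\<alpha>..\<beta>}" if t: "\<alpha> \<le> t" "t < \<alpha> + 2 * pi"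
      proof
        assume "cis t \<in> I"
        then obtain u where u: "cis t = cis u" "\<alpha> \<le> u" "u \<le> \<beta>"
          using I(2) by auto
        \<comment> \<open>Strictness uses \<open>t \<noteq> \<alpha>\<close>: the full circle
          \<open>\<beta> = \<alpha> + 2 * pi\<close> is allowed, and there
          \<open>cis \<alpha>\<close> and \<open>cis \<beta>\<close> coincide.\<close>
        have "\<bar>t - u\<bar> < 2 * pi"
          using t u le elim by linarith
        with u show "t \<in> {\<alpha>..\<beta>}"
          using cis_inj_on_period[of t u] by simp
      next
        assume "t \<in> {\<alpha>..\<beta>}"
        then have "t \<in> {\<alpha><..<\<beta>}" using elim by auto
        then show "cis t \<in> I" using I(1) by blast
      qed
      then show ?case
        using le elim by (auto simp: indicator_def)
    qed
  qed measurable
  also have "\<dots> = F \<beta> - F \<alpha>"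
  proof (rule integral_FTC_Icc[OF le(1)])
    show "(F has_vector_derivative h (cis t)) (at t within {\<alpha>..\<beta>})" for t
      using F[of t] has_vector_derivative_at_within
      by (simp add: has_real_derivative_iff_has_vector_derivative)
  qed (rule continuous_on_subset[OF ch], simp)
  finally show ?thesis .
qed

section \<open>Harmonic functions and real parts of holomorphic functions\<close>

lemma has_derivative_along_line:
  fixes f :: "complex \<Rightarrow> real"
  assumes "(f has_derivative D) (at (c + of_real u * a))"
  shows "((\<lambda>u. f (c + of_real u * a)) has_real_derivative D a) (at u)"
proof -
  have "((\<lambda>u::real. c + of_real u * a) has_derivative (\<lambda>v. of_real v * a)) (at u)"
    by (auto intro!: derivative_eq_intros)
  from has_derivative_compose[OF this assms]
  have "((\<lambda>u. f (c + of_real u * a)) has_derivative (\<lambda>v. D (of_real v * a))) (at u)" .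
  moreover have "D (of_real v * a) = D a * v" for v
    using linear_scale[OF has_derivative_linear[OF assms], of v a]
    by (simp add: scaleR_conv_of_real)
  ultimately show ?thesis
    by (simp add: has_field_derivative_def)
qed

text \<open>The second difference is symmetric in \<open>a\<close> and \<open>b\<close>, whereas the
  right side differentiates along \<open>a\<close> first; using it in both orders compares the two
  mixed partials. The mean value theorem is applied twice: along \<open>a\<close> to the increment
  of \<open>f\<close> by \<open>s * b\<close>, then along \<open>b\<close> to the derivative in
  direction \<open>a\<close>.\<close>

lemma second_difference_MVT:
  fixes f :: "complex \<Rightarrow> real"
  assumes s: "0 < s" "norm a = 1" "norm b = 1"
    and f: "\<And>w. norm (w - z) \<le> 2 * s \<Longrightarrow> (f has_derivative f' w) (at w)"
    and fa: "\<And>w. norm (w - z) \<le> 2 * s \<Longrightarrow> ((\<lambda>w. f' w a) has_derivative D w) (at w)"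
  shows "\<exists>w. norm (w - z) \<le> 2 * s \<and>
    f (z + of_real s * a + of_real s * b) - f (z + of_real s * a) - f (z + of_real s * b) + f z
      = s\<^sup>2 * D w b"
proof -
  have near: "norm (z + of_real u * a + of_real v * b - z) \<le> 2 * s"
    if "0 \<le> u" "u \<le> s" "0 \<le> v" "v \<le> s" for u v
    using that s norm_triangle_ineq[of "of_real u * a" "of_real v * b"]
    by (simp add: norm_mult)
  define \<phi> where "\<phi> u = f (z + of_real s * b + of_real u * a) - f (z + of_real u * a)" for u :: real
  have "(\<phi> has_real_derivative
      (f' (z + of_real s * b + of_real u * a) a - f' (z + of_real u * a) a)) (at u)"
    if u: "0 \<le> u" "u \<le> s" for u
    unfolding \<phi>_def
    using near[OF u, of s] near[OF u, of 0] s
    by (intro DERIV_diff has_derivative_along_line f) (simp_all add: algebra_simps)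
  from MVT2[OF s(1) this] obtain \<xi> where \<xi>: "0 < \<xi>" "\<xi> < s"
    and 1: "\<phi> s - \<phi> 0 = s * (f' (z + of_real s * b + of_real \<xi> * a) a - f' (z + of_real \<xi> * a) a)"
    by auto
  have "((\<lambda>v. f' (z + of_real \<xi> * a + of_real v * b) a) has_real_derivative
      D (z + of_real \<xi> * a + of_real v * b) b) (at v)" if v: "0 \<le> v" "v \<le> s" for v
    using near[OF _ _ v, of \<xi>] \<xi> by (intro has_derivative_along_line fa) simp
  from MVT2[OF s(1) this] obtain \<eta> where \<eta>: "0 < \<eta>" "\<eta> < s"
    and 2: "f' (z + of_real \<xi> * a + of_real s * b) a - f' (z + of_real \<xi> * a) a
      = s * D (z + of_real \<xi> * a + of_real \<eta> * b) b"
    by auto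
  have "norm (z + of_real \<xi> * a + of_real \<eta> * b - z) \<le> 2 * s"
    using near[of \<xi> \<eta>] \<xi> \<eta> by simp
  moreover have "\<phi> s - \<phi> 0 = s\<^sup>2 * D (z + of_real \<xi> * a + of_real \<eta> * b) b"
    using 1 2 by (simp add: add_ac power2_eq_square)
  ultimately show ?thesis
    unfolding \<phi>_def by (intro exI conjI) (assumption, simp add: algebra_simps)
qed

text \<open>Schwarz's theorem. In \<open>harmonic_on\<close> the functions \<open>fxy\<close> and
  \<open>fyx\<close> are separate witnesses, and their equality is one of the two Cauchy-Riemann
  equations for the complex gradient.\<close>

lemma mixed_partials_equal:
  fixes f fx fy fxx fxy fyx fyy :: "complex \<Rightarrow> real"
  assumes S: "open S" "z \<in> S"
    and cont: "continuous_on S fxy" "continuous_on S fyx"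
    and f: "\<And>z. z \<in> S \<Longrightarrow> (f has_derivative (\<lambda>h. fx z * Re h + fy z * Im h)) (at z)"
    and fx: "\<And>z. z \<in> S \<Longrightarrow> (fx has_derivative (\<lambda>h. fxx z * Re h + fxy z * Im h)) (at z)"
    and fy: "\<And>z. z \<in> S \<Longrightarrow> (fy has_derivative (\<lambda>h. fyx z * Re h + fyy z * Im h)) (at z)"
  shows "fxy z = fyx z"
proof (rule ccontr)
  assume ne: "fxy z \<noteq> fyx z"
  \<comment> \<open>Half the gap: the common value of \<open>fxy w\<close> and \<open>fyx v\<close>
    cannot be closer than \<open>e\<close> to both \<open>fxy z\<close> and
    \<open>fyx z\<close>.\<close>
  define e where "e = \<bar>fxy z - fyx z\<bar> / 2"
  have e: "e > 0" using ne by (simp add: e_def)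
  have "isCont fxy z" "isCont fyx z"
    using cont S by (auto simp: continuous_on_eq_continuous_at)
  then obtain d1 d2 where d: "d1 > 0" "d2 > 0"
    and d1: "\<And>w. dist w z < d1 \<Longrightarrow> dist (fxy w) (fxy z) < e"
    and d2: "\<And>w. dist w z < d2 \<Longrightarrow> dist (fyx w) (fyx z) < e"
    using e unfolding continuous_at_eps_delta dist_norm real_norm_def by metis
  obtain d3 where d3: "d3 > 0" "ball z d3 \<subseteq> S"
    using S openE by blast
  \<comment> \<open>The intermediate points lie within \<open>2 * s\<close> of \<open>z\<close>, and
    a quarter of the smallest radius keeps \<open>2 * s\<close> strictly below all three.\<close>
  define s where "s = min d1 (min d2 d3) / 4"
  have s: "s > 0" "2 * s < d1" "2 * s < d2" "2 * s < d3"
    using d d3 by (auto simp: s_def min_def)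
  have inS: "w \<in> S" if "norm (w - z) \<le> 2 * s" for w
  proof -
    have "w \<in> ball z d3" using that s(4) by (simp add: dist_norm norm_minus_commute)
    then show ?thesis using d3 by blast
  qed
  from second_difference_MVT[of s 1 \<i> z f "\<lambda>z h. fx z * Re h + fy z * Im h"
      "\<lambda>z h. fxx z * Re h + fxy z * Im h"] s(1) f fx inS
  obtain w where w: "norm (w - z) \<le> 2 * s"
    and w': "f (z + of_real s + of_real s * \<i>) - f (z + of_real s) - f (z + of_real s * \<i>) + f z
      = s\<^sup>2 * fxy w"
    by auto
  from second_difference_MVT[of s \<i> 1 z f "\<lambda>z h. fx z * Re h + fy z * Im h"
      "\<lambda>z h. fyx z * Re h + fyy z * Im h"] s(1) f fy inS
  obtain v where v: "norm (v - z) \<le> 2 * s"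
    and v': "f (z + of_real s * \<i> + of_real s) - f (z + of_real s * \<i>) - f (z + of_real s) + f z
      = s\<^sup>2 * fyx v"
    by auto
  have "s\<^sup>2 * fxy w = s\<^sup>2 * fyx v"
    using w' v' by (simp add: algebra_simps)
  then have "fxy w = fyx v" using s by simp
  moreover have "dist (fxy w) (fxy z) < e" "dist (fyx v) (fyx z) < e"
    using d1[of w] d2[of v] w v s by (auto simp: dist_norm)
  ultimately show False
    by (auto simp: e_def dist_norm abs_if split: if_splits)
qed

text \<open>If \<open>f = Re G\<close>, then the derivative of \<open>G\<close> must be
  \<open>fx - \<i> * fy\<close>. The vanishing Laplacian and the symmetry of the mixed partials are
  exactly the Cauchy-Riemann equations for this function, and the convex ball gives it a primitive.
  The real part of the primitive has the gradient of \<open>f\<close>, so it differs from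
  \<open>f\<close> by a real constant, which is absorbed into \<open>G\<close>.\<close>

lemma harmonic_on_ball_real_part:
  assumes "harmonic_on f (ball a R)"
  obtains G g where "\<And>z. z \<in> ball a R \<Longrightarrow> (G has_field_derivative g z) (at z)"
    and "\<And>z. z \<in> ball a R \<Longrightarrow> f z = Re (G z)"
    and "\<And>z. z \<in> ball a R \<Longrightarrow> (f has_derivative (\<lambda>h. Re (g z * h))) (at z)"
proof -
  let ?S = "ball a R"
  obtain fx fy fxx fxy fyx fyy where
    c: "continuous_on ?S fxy" "continuous_on ?S fyx"
    and f: "\<And>z. z \<in> ?S \<Longrightarrow> (f has_derivative (\<lambda>h. fx z * Re h + fy z * Im h)) (at z)"
    and fx: "\<And>z. z \<in> ?S \<Longrightarrow> (fx has_derivative (\<lambda>h. fxx z * Re h + fxy z * Im h)) (at z)"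
    and fy: "\<And>z. z \<in> ?S \<Longrightarrow> (fy has_derivative (\<lambda>h. fyx z * Re h + fyy z * Im h)) (at z)"
    and lap: "\<And>z. z \<in> ?S \<Longrightarrow> fxx z + fyy z = 0"
    using assms unfolding harmonic_on_def by blast
  define g where "g z = of_real (fx z) - \<i> * of_real (fy z)" for z
  have f': "(f has_derivative (\<lambda>h. Re (g z * h))) (at z)" if "z \<in> ?S" for z
    using f[OF that] by (simp add: g_def)
  have "(g has_field_derivative (of_real (fxx z) - \<i> * of_real (fyx z))) (at z)" if z: "z \<in> ?S" for z
  proof -
    have sym: "fxy z = fyx z"
      by (rule mixed_partials_equal[OF _ z c f fx fy]) auto
    have "(g has_derivative (\<lambda>h. of_real (fxx z * Re h + fxy z * Im h)
        - \<i> * of_real (fyx z * Re h + fyy z * Im h))) (at z)"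
      unfolding g_def using z
      by (intro has_derivative_diff has_derivative_mult_right has_derivative_of_real fx fy)
    moreover have "of_real (fxx z * Re h + fxy z * Im h) - \<i> * of_real (fyx z * Re h + fyy z * Im h)
        = (of_real (fxx z) - \<i> * of_real (fyx z)) * h" for h
      using lap[OF z] sym by (simp add: complex_eq_iff algebra_simps add_eq_0_iff)
    ultimately show ?thesis
      by (simp add: has_field_derivative_def)
  qed
  then have "g holomorphic_on ?S"
    unfolding holomorphic_on_open[OF open_ball] by blast
  then obtain G0 where G0: "\<And>z. z \<in> ?S \<Longrightarrow> (G0 has_field_derivative g z) (at z within ?S)"
    using holomorphic_convex_primitive'[of ?S g] by auto
  then have G0: "\<And>z. z \<in> ?S \<Longrightarrow> (G0 has_field_derivative g z) (at z)"
    by (simp add: at_within_open[of _ ?S])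
  have "((\<lambda>z. f z - Re (G0 z)) has_derivative (\<lambda>h. 0)) (at z within ?S)" if "z \<in> ?S" for z
  proof -
    have "((\<lambda>z. f z - Re (G0 z)) has_derivative (\<lambda>h. Re (g z * h) - Re (g z * h))) (at z)"
      using that G0[OF that]
      by (intro has_derivative_diff f' has_derivative_Re) (auto simp: has_field_derivative_def)
    then show ?thesis by (simp add: has_derivative_at_withinI)
  qed
  then obtain k where k: "\<And>z. z \<in> ?S \<Longrightarrow> f z - Re (G0 z) = k"
    using has_derivative_zero_constant[of ?S "\<lambda>z. f z - Re (G0 z)"] by auto
  show ?thesis
  proof (rule that[of "\<lambda>z. G0 z + of_real k" g])
    show "((\<lambda>z. G0 z + of_real k) has_field_derivative g z) (at z)" if "z \<in> ?S" for z
      using G0[OF that] by (auto intro!: derivative_eq_intros)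
    show "f z = Re (G0 z + of_real k)" if "z \<in> ?S" for z
      using k[OF that] by simp
  qed (use f' in auto)
qed

text \<open>The witnesses are read off from
  \<open>Re (H' * h) = Re H' * Re h - Im H' * Im h\<close>, at \<open>H'\<close> and once more at
  its derivative \<open>H2\<close>; the pure second partials are then \<open>Re H2\<close> and
  \<open>- Re H2\<close>. Their continuity holds because derivatives of holomorphic functions are
  holomorphic.\<close>

lemma harmonic_on_Re:
  assumes S: "open S" and H: "\<And>z. z \<in> S \<Longrightarrow> (H has_field_derivative H' z) (at z)"
    and f: "\<And>z. z \<in> S \<Longrightarrow> f z = Re (H z)"
  shows "harmonic_on f S"
proof -
  have "H holomorphic_on S"
    using H S by (auto simp: holomorphic_on_open)
  then have "deriv H holomorphic_on S"
    using S by (rule holomorphic_deriv)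
  moreover have eq: "deriv H z = H' z" if "z \<in> S" for z
    using H[OF that] by (rule DERIV_imp_deriv)
  ultimately have h': "H' holomorphic_on S"
    using holomorphic_cong[of S S "deriv H" H'] by simp
  define H2 where "H2 = deriv H'"
  have H2: "(H' has_derivative (\<lambda>h. H2 z * h)) (at z)" if "z \<in> S" for z
    using holomorphic_derivI[OF h' S that] by (simp add: H2_def has_field_derivative_def)
  have "H2 holomorphic_on S"
    unfolding H2_def using h' S by (rule holomorphic_deriv)
  then have cont: "continuous_on S H2"
    by (rule holomorphic_on_imp_continuous_on)
  show ?thesis
    unfolding harmonic_on_def
  proof (intro conjI S exI ballI)
    show "continuous_on S (\<lambda>z. Re (H2 z))" "continuous_on S (\<lambda>z. - Im (H2 z))"
      "continuous_on S (\<lambda>z. - Im (H2 z))" "continuous_on S (\<lambda>z. - Re (H2 z))"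
      by (intro continuous_intros cont)+
    fix z assume z: "z \<in> S"
    have "((\<lambda>z. Re (H z)) has_derivative (\<lambda>h. Re (H' z * h))) (at z)"
      using H[OF z] by (intro has_derivative_Re) (simp add: has_field_derivative_def)
    then have "(f has_derivative (\<lambda>h. Re (H' z * h))) (at z)"
      by (rule has_derivative_transform_within_open[OF _ S z]) (simp add: f)
    then show "(f has_derivative (\<lambda>h. Re (H' z) * Re h + - Im (H' z) * Im h)) (at z)"
      by simp
    show "((\<lambda>z. Re (H' z)) has_derivative (\<lambda>h. Re (H2 z) * Re h + - Im (H2 z) * Im h)) (at z)"
      using has_derivative_Re[OF H2[OF z]] by simp
    show "((\<lambda>z. - Im (H' z)) has_derivative (\<lambda>h. - Im (H2 z) * Re h + - Re (H2 z) * Im h)) (at z)"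
      using has_derivative_minus[OF has_derivative_Im[OF H2[OF z]]] by (simp add: algebra_simps)
  qed simp
qed

section \<open>Fourier coefficients on circles inside the disc\<close>

text \<open>Cauchy's formula gives the Fourier coefficient of \<open>G\<close> of index \<open>1\<close>, Cauchy's theorem kills
  that of index \<open>-1\<close>; adding the conjugate of the latter isolates the real part.\<close>

lemma holomorphic_circle_means:
  assumes G: "G holomorphic_on ball 0 1" and r: "0 < r" "r < 1"
  shows "(\<integral>\<zeta>. G (of_real r * \<zeta>) \<partial>arc_length_measure) = 2 * of_real pi * G 0" (is ?A)
    and "(\<integral>\<zeta>. of_real (Re (G (of_real r * \<zeta>))) * cnj \<zeta> \<partial>arc_length_measure)
      = of_real (pi * r) * deriv G 0" (is ?B)
proof -
  have cG: "continuous_on (cball 0 r) G"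
    using r by (intro holomorphic_on_imp_continuous_on holomorphic_on_subset[OF G]) auto
  have hG: "G holomorphic_on ball 0 r"
    using r by (intro holomorphic_on_subset[OF G]) auto
  have cGr [continuous_intros]: "continuous_on unit_circle (\<lambda>\<zeta>. G (of_real r * \<zeta>))"
    using r by (intro continuous_on_compose2[OF cG] continuous_intros) (auto simp: norm_mult)
  \<comment> \<open>The factor \<open>of_real r * \<i> * cis t\<close> is the velocity of the
    circular path. It cancels the kernel \<open>1 / u\<close> up to \<open>\<i>\<close>, and reduces
    \<open>1 / u\<^sup>2\<close> to \<open>cnj \<zeta>\<close> times \<open>\<i> / r\<close>,
    because \<open>1 / \<zeta> = cnj \<zeta>\<close> on the circle.\<close>
  have ci: "((\<lambda>t. k (of_real r * cis t) * of_real r * \<i> * cis t) has_integral I) {0..2 * pi}"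
    if "(k has_contour_integral I) (circlepath 0 r)" for k I
    using that has_contour_integral_part_circlepath_iff[of 0 "2 * pi" k I 0 "of_real r"]
    by (simp add: circlepath_def)
  have eqI: "(\<integral>\<zeta>. k (of_real r * \<zeta>) * of_real r * \<i> * \<zeta> \<partial>arc_length_measure) = I"
    if "(k has_contour_integral I) (circlepath 0 r)" "continuous_on unit_circle (\<lambda>\<zeta>. k (of_real r * \<zeta>))" for k I
    by (rule has_integral_unique[OF has_integral_arc_length ci[OF that(1)]])
       (intro continuous_intros that(2))
  have nz: "\<zeta> \<noteq> 0" if "\<zeta> \<in> unit_circle" for \<zeta> using that by auto
  have "((\<lambda>u. G u / (u - 0)) has_contour_integral (2 * of_real pi * \<i> * G 0)) (circlepath 0 r)"
    using r by (intro Cauchy_integral_circlepath cG hG) auto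
  moreover have "continuous_on unit_circle (\<lambda>\<zeta>. G (of_real r * \<zeta>) / (of_real r * \<zeta> - 0))"
    using r nz by (intro continuous_intros) auto
  ultimately
  have "(\<integral>\<zeta>. G (of_real r * \<zeta>) / (of_real r * \<zeta> - 0) * of_real r * \<i> * \<zeta> \<partial>arc_length_measure)
      = 2 * of_real pi * \<i> * G 0"
    by (rule eqI)
  also have "(\<integral>\<zeta>. G (of_real r * \<zeta>) / (of_real r * \<zeta> - 0) * of_real r * \<i> * \<zeta> \<partial>arc_length_measure)
      = (\<integral>\<zeta>. \<i> * G (of_real r * \<zeta>) \<partial>arc_length_measure)"
    using r nz by (intro Bochner_Integration.integral_cong) auto
  finally show ?A by simp
  have "((\<lambda>u. G u / (u - 0)\<^sup>2) has_contour_integral (2 * of_real pi * \<i> * deriv G 0)) (circlepath 0 r)"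
  proof -
    have "0 \<in> ball (0::complex) r" using r by auto
    note * = Cauchy_derivative_integral_circlepath[OF cG hG this]
    then have "deriv G 0 = 1 / (2 * of_real pi * \<i>) * contour_integral (circlepath 0 r) (\<lambda>u. G u / (u - 0)\<^sup>2)"
      by (intro DERIV_imp_deriv)
    then have "contour_integral (circlepath 0 r) (\<lambda>u. G u / (u - 0)\<^sup>2) = 2 * of_real pi * \<i> * deriv G 0"
      by (simp add: field_simps)
    then show ?thesis
      using *(1) has_contour_integral_integral by metis
  qed
  moreover have "continuous_on unit_circle (\<lambda>\<zeta>. G (of_real r * \<zeta>) / (of_real r * \<zeta> - 0)\<^sup>2)"
    using r nz by (intro continuous_intros) auto
  ultimately
  have "(\<integral>\<zeta>. G (of_real r * \<zeta>) / (of_real r * \<zeta> - 0)\<^sup>2 * of_real r * \<i> * \<zeta> \<partial>arc_length_measure)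
      = 2 * of_real pi * \<i> * deriv G 0"
    by (rule eqI)
  also have "(\<integral>\<zeta>. G (of_real r * \<zeta>) / (of_real r * \<zeta> - 0)\<^sup>2 * of_real r * \<i> * \<zeta> \<partial>arc_length_measure)
      = (\<integral>\<zeta>. (\<i> / of_real r) * (G (of_real r * \<zeta>) * cnj \<zeta>) \<partial>arc_length_measure)"
  proof (intro Bochner_Integration.integral_cong refl)
    fix \<zeta> assume "\<zeta> \<in> space arc_length_measure"
    then have "cmod \<zeta> = 1" by simp
    then have "\<zeta> * cnj \<zeta> = 1"
      by (metis complex_norm_square of_real_1 one_power2)
    then have "cnj \<zeta> = 1 / \<zeta>"
      by (metis nonzero_mult_div_cancel_left mult_zero_left zero_neq_one)
    then show "G (of_real r * \<zeta>) / (of_real r * \<zeta> - 0)\<^sup>2 * of_real r * \<i> * \<zeta>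
        = (\<i> / of_real r) * (G (of_real r * \<zeta>) * cnj \<zeta>)"
      using r \<open>cmod \<zeta> = 1\<close> by (auto simp: field_simps power2_eq_square)
  qed
  finally have pos: "(\<integral>\<zeta>. G (of_real r * \<zeta>) * cnj \<zeta> \<partial>arc_length_measure) = 2 * of_real (pi * r) * deriv G 0"
    using r by (simp add: field_simps)
  have "(G has_contour_integral 0) (circlepath 0 r)"
    using r by (intro Cauchy_theorem_disc_simple[OF G]) auto
  from eqI[OF this cGr]
  have "(\<integral>\<zeta>. of_real r * \<i> * (G (of_real r * \<zeta>) * \<zeta>) \<partial>arc_length_measure) = 0"
    by (simp add: mult_ac)
  then have neg: "(\<integral>\<zeta>. G (of_real r * \<zeta>) * \<zeta> \<partial>arc_length_measure) = 0"
    using r by simp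
  have neg': "(\<integral>\<zeta>. cnj (G (of_real r * \<zeta>) * \<zeta>) \<partial>arc_length_measure) = 0"
    by (subst Bochner_Integration.integral_cnj) (simp only: neg complex_cnj_zero)
  have "(\<integral>\<zeta>. of_real (Re (G (of_real r * \<zeta>))) * cnj \<zeta> \<partial>arc_length_measure)
     = (\<integral>\<zeta>. 1/2 * (G (of_real r * \<zeta>) * cnj \<zeta> + cnj (G (of_real r * \<zeta>) * \<zeta>)) \<partial>arc_length_measure)"
    by (intro Bochner_Integration.integral_cong) (auto simp: complex_eq_iff)
  also have "\<dots> = 1/2 * (\<integral>\<zeta>. G (of_real r * \<zeta>) * cnj \<zeta> + cnj (G (of_real r * \<zeta>) * \<zeta>) \<partial>arc_length_measure)"
    by (rule integral_mult_right_zero)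
  also have "\<dots> = 1/2 * ((\<integral>\<zeta>. G (of_real r * \<zeta>) * cnj \<zeta> \<partial>arc_length_measure)
      + (\<integral>\<zeta>. cnj (G (of_real r * \<zeta>) * \<zeta>) \<partial>arc_length_measure))"
    by (subst Bochner_Integration.integral_add)
       (auto intro!: integrable_arc_length_continuous continuous_intros)
  finally show ?B
    using pos neg' by simp
qed

text \<open>The weight \<open>Re (\<zeta> * cnj e)\<close> is also
  \<open>Re (e * cnj \<zeta>)\<close>, so the second integral is the real part of \<open>e\<close>
  times the coefficient computed for \<open>G\<close>. By uniqueness of the derivative,
  \<open>D e\<close> is the real part of \<open>e\<close> times \<open>deriv G 0\<close>.\<close>

lemma harmonic_circle_means:
  assumes f: "harmonic_on f unit_disc" and r: "0 < r" "r < 1"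
    and D: "(f has_derivative D) (at 0)"
  shows "(\<integral>\<zeta>. f (of_real r * \<zeta>) \<partial>arc_length_measure) = 2 * pi * f 0"
    and "(\<integral>\<zeta>. f (of_real r * \<zeta>) * Re (\<zeta> * cnj e) \<partial>arc_length_measure) = pi * r * D e"
proof -
  obtain G g where G: "\<And>z. z \<in> unit_disc \<Longrightarrow> (G has_field_derivative g z) (at z)"
    and fG: "\<And>z. z \<in> unit_disc \<Longrightarrow> f z = Re (G z)"
    and fd: "\<And>z. z \<in> unit_disc \<Longrightarrow> (f has_derivative (\<lambda>h. Re (g z * h))) (at z)"
    using harmonic_on_ball_real_part[OF f] by metis
  have hol: "G holomorphic_on ball 0 1"
    unfolding holomorphic_on_open[OF open_ball] using G by blast
  have D': "D e = Re (g 0 * e)"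
    using has_derivative_unique[OF D fd] by simp
  have g: "deriv G 0 = g 0"
    using G[of 0] by (intro DERIV_imp_deriv) simp
  have fr: "f (of_real r * \<zeta>) = Re (G (of_real r * \<zeta>))" if "\<zeta> \<in> unit_circle" for \<zeta>
    using that r by (intro fG) (simp add: norm_mult)
  have cGr [continuous_intros]: "continuous_on unit_circle (\<lambda>\<zeta>. G (of_real r * \<zeta>))"
    using r by (intro continuous_on_compose2[OF holomorphic_on_imp_continuous_on[OF hol]]
        continuous_intros) (auto simp: norm_mult)
  have "(\<integral>\<zeta>. f (of_real r * \<zeta>) \<partial>arc_length_measure) = (\<integral>\<zeta>. Re (G (of_real r * \<zeta>)) \<partial>arc_length_measure)"
    by (intro Bochner_Integration.integral_cong) (auto simp: fr)
  also have "\<dots> = Re (2 * of_real pi * G 0)"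
    using holomorphic_circle_means(1)[OF hol r]
    by (subst integral_Re) (auto intro!: integrable_arc_length_continuous continuous_intros)
  finally show "(\<integral>\<zeta>. f (of_real r * \<zeta>) \<partial>arc_length_measure) = 2 * pi * f 0"
    by (simp add: fG)
  have "(\<integral>\<zeta>. f (of_real r * \<zeta>) * Re (\<zeta> * cnj e) \<partial>arc_length_measure)
     = (\<integral>\<zeta>. Re (e * (of_real (Re (G (of_real r * \<zeta>))) * cnj \<zeta>)) \<partial>arc_length_measure)"
  proof (intro Bochner_Integration.integral_cong refl)
    fix \<zeta> assume "\<zeta> \<in> space arc_length_measure"
    then have "f (of_real r * \<zeta>) = Re (G (of_real r * \<zeta>))"
      by (intro fr) simp
    then show "f (of_real r * \<zeta>) * Re (\<zeta> * cnj e)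
        = Re (e * (of_real (Re (G (of_real r * \<zeta>))) * cnj \<zeta>))"
      by (simp add: algebra_simps)
  qed
  also have "\<dots> = Re (\<integral>\<zeta>. e * (of_real (Re (G (of_real r * \<zeta>))) * cnj \<zeta>) \<partial>arc_length_measure)"
    by (rule integral_Re) (auto intro!: integrable_arc_length_continuous continuous_intros)
  also have "(\<integral>\<zeta>. e * (of_real (Re (G (of_real r * \<zeta>))) * cnj \<zeta>) \<partial>arc_length_measure)
      = e * (of_real (pi * r) * deriv G 0)"
    using holomorphic_circle_means(2)[OF hol r] by simp
  also have "Re \<dots> = pi * r * D e"
    by (simp add: D' g algebra_simps)
  finally show "(\<integral>\<zeta>. f (of_real r * \<zeta>) * Re (\<zeta> * cnj e) \<partial>arc_length_measure) = pi * r * D e" .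
qed

section \<open>Null sets and moments on the circle\<close>

lemma cis_surj_circle:
  assumes "norm z = 1"
  obtains t where "z = cis t"
  using assms cis_Arg[of z] by (metis norm_zero sgn_div_norm inverse_1 scaleR_one zero_neq_one)

lemma AE_arc_length_singleton: "AE \<zeta> in arc_length_measure. \<zeta> \<noteq> z"
proof (cases "norm z = 1")
  case True
  then obtain s where s: "z = cis s" by (rule cis_surj_circle)
  have "{\<zeta>\<in>unit_circle. \<zeta> \<noteq> z} = unit_circle \<inter> (- {z})" by auto
  also have "\<dots> \<in> sets (restrict_space borel unit_circle)"
    unfolding sets_restrict_space by (rule imageI) simp
  finally have m: "{\<zeta>\<in>unit_circle. \<zeta> \<noteq> z} \<in> sets (restrict_space borel unit_circle)" .
  \<comment> \<open>With the period started at \<open>s\<close>, the angle \<open>s\<close> is the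
    only preimage of \<open>z\<close> in the window.\<close>
  have "AE t in lborel. t \<in> {s..<s + 2 * pi} \<longrightarrow> cis t \<noteq> z"
    using AE_lborel_singleton[of s]
    by eventually_elim (use cis_inj_on_period s in fastforce)
  then show ?thesis
    by (subst AE_arc_length_iff[OF m])
qed (auto intro!: AE_I2)

lemma integral_circle_FTC:
  fixes h :: "complex \<Rightarrow> real"
  assumes "continuous_on unit_circle h" "\<And>t. (F has_real_derivative h (cis t)) (at t)"
  shows "(\<integral>\<zeta>. h \<zeta> \<partial>arc_length_measure) = F (2 * pi) - F 0"
proof -
  have "unit_circle \<subseteq> cis ` {0..2 * pi}"
  proof
    fix z :: complex assume "z \<in> unit_circle"
    then have z: "norm z = 1" by simp
    then have "z = cis (Arg2pi z)"
      using Arg2pi_eq[of z] by (simp add: cis_conv_exp)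
    then show "z \<in> cis ` {0..2 * pi}"
      using Arg2pi_ge_0[of z] Arg2pi_lt_2pi[of z] by force
  qed
  then have "(\<integral>\<zeta>. h \<zeta> * indicator unit_circle \<zeta> \<partial>arc_length_measure) = F (2 * pi) - F 0"
    by (intro integral_arc_FTC assms) auto
  moreover have "(\<integral>\<zeta>. h \<zeta> * indicator unit_circle \<zeta> \<partial>arc_length_measure) = (\<integral>\<zeta>. h \<zeta> \<partial>arc_length_measure)"
    by (intro Bochner_Integration.integral_cong) auto
  ultimately show ?thesis by simp
qed

lemma Re_cis_mult_cnj_cis: "Re (cis t * cnj (cis \<theta>)) = cos (t - \<theta>)"
  by (simp add: cos_diff)

lemma integral_circle_const: "(\<integral>\<zeta>. c \<partial>arc_length_measure) = 2 * pi * (c::real)"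
  by (subst integral_circle_FTC[where F = "\<lambda>t. c * t"])
     (auto intro!: derivative_eq_intros)

lemma integral_circle_direction:
  "(\<integral>\<zeta>. Re (\<zeta> * cnj e) \<partial>arc_length_measure) = 0"
  by (subst integral_circle_FTC[where F = "\<lambda>t. Re e * sin t - Im e * cos t"])
     (auto intro!: derivative_eq_intros continuous_intros)

lemma is_circle_arc_norm: "is_circle_arc I c L \<Longrightarrow> norm c = 1"
  by (auto simp: is_circle_arc_def)

lemma is_circle_arc_sets: "is_circle_arc I c L \<Longrightarrow> I \<in> sets arc_length_measure"
  unfolding is_circle_arc_def using arc_borel sets_arc_length_measure by blast

text \<open>For \<open>L = 2 * pi * q\<close> the second value is \<open>2 * sin (pi * q)\<close>,
  the source of the sine in \<open>A_coef\<close>.\<close>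

lemma integral_circle_arc:
  assumes "is_circle_arc I c L"
  shows "(\<integral>\<zeta>. indicator I \<zeta> \<partial>arc_length_measure) = L"
    and "(\<integral>\<zeta>. Re (\<zeta> * cnj c) * indicator I \<zeta> \<partial>arc_length_measure) = 2 * sin (L / 2)"
proof -
  obtain \<theta> where L: "0 < L" "L < 2 * pi" and \<theta>: "c = cis \<theta>"
    and I: "cis ` {\<theta> - L / 2 <..< \<theta> + L / 2} \<subseteq> I" "I \<subseteq> cis ` {\<theta> - L / 2 .. \<theta> + L / 2}"
    using assms unfolding is_circle_arc_def by blast
  have "(\<integral>\<zeta>. 1 * indicator I \<zeta> \<partial>arc_length_measure) = (\<theta> + L / 2) - (\<theta> - L / 2)"
    using L by (intro integral_arc_FTC[OF I]) (auto intro!: derivative_eq_intros)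
  then show "(\<integral>\<zeta>. indicator I \<zeta> \<partial>arc_length_measure) = L" by simp
  have "(\<integral>\<zeta>. Re (\<zeta> * cnj c) * indicator I \<zeta> \<partial>arc_length_measure)
      = sin (\<theta> + L / 2 - \<theta>) - sin (\<theta> - L / 2 - \<theta>)"
  proof (rule integral_arc_FTC[OF I])
    fix t
    show "((\<lambda>t. sin (t - \<theta>)) has_real_derivative Re (cis t * cnj c)) (at t)"
      unfolding \<theta> Re_cis_mult_cnj_cis by (auto intro!: derivative_eq_intros)
  qed (use L in \<open>auto intro!: continuous_intros\<close>)
  then show "(\<integral>\<zeta>. Re (\<zeta> * cnj c) * indicator I \<zeta> \<partial>arc_length_measure) = 2 * sin (L / 2)"
    by simp
qed

section \<open>Caps and the bathtub principle\<close>

text \<open>The cap is cut out by a half plane rather than by angles because the bathtub argument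
  compares the weight with a threshold. The threshold \<open>cos (pi * q)\<close> is the weight at
  angular distance \<open>pi * q\<close> from \<open>e\<close>, which makes the total length
  \<open>2 * pi * q\<close>.\<close>

definition circle_cap :: "complex \<Rightarrow> real \<Rightarrow> complex set" where
  "circle_cap e q = {\<zeta> \<in> unit_circle. cos (pi * q) < Re (\<zeta> * cnj e)}"

text \<open>The relative angle is kept within \<open>pi\<close> because the cosine is strictly
  decreasing in \<open>\<bar>u\<bar>\<close> there, so the weight determines
  \<open>\<bar>u\<bar>\<close>.\<close>

lemma circle_angle_from:
  assumes "norm \<zeta> = 1"
  obtains u where "\<bar>u\<bar> \<le> pi" "\<zeta> = cis (\<theta> + u)"
proof -
  have n: "norm (\<zeta> * cnj (cis \<theta>)) = 1"
    using assms by (simp add: norm_mult)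
  then have "cis (Arg (\<zeta> * cnj (cis \<theta>))) = \<zeta> * cnj (cis \<theta>)"
    using cis_Arg[of "\<zeta> * cnj (cis \<theta>)"] by (metis norm_zero sgn_div_norm inverse_1 scaleR_one zero_neq_one)
  then have "cis (\<theta> + Arg (\<zeta> * cnj (cis \<theta>))) = cis \<theta> * (\<zeta> * cnj (cis \<theta>))"
    by (simp add: cis_mult[symmetric])
  also have "\<dots> = \<zeta>"
    by (simp add: cis_cnj cis_mult mult.left_commute[of _ \<zeta>])
  finally show ?thesis
    using that[of "Arg (\<zeta> * cnj (cis \<theta>))"] Arg_bounded[of "\<zeta> * cnj (cis \<theta>)"] by auto
qed

lemma is_circle_arc_cap:
  assumes e: "norm e = 1" and q: "0 < q" "q < 1"
  shows "is_circle_arc (circle_cap e q) e (2 * pi * q)"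
proof -
  obtain \<theta> where \<theta>: "e = cis \<theta>" using e by (rule cis_surj_circle)
  have pq: "0 < pi * q" "pi * q < pi" using q by auto
  have "cis t \<in> circle_cap e q" if t: "t \<in> {\<theta> - pi * q<..<\<theta> + pi * q}" for t
  proof -
    have "cos (pi * q) < cos \<bar>t - \<theta>\<bar>"
      using t pq by (intro cos_monotone_0_pi) auto
    then show ?thesis
      unfolding circle_cap_def \<theta> by (simp add: Re_cis_mult_cnj_cis del: cis_cnj times_complex.sel)
  qed
  moreover have "\<zeta> \<in> cis ` {\<theta> - pi * q..\<theta> + pi * q}" if \<zeta>: "\<zeta> \<in> circle_cap e q" for \<zeta>
  proof -
    have "norm \<zeta> = 1" using \<zeta> by (simp add: circle_cap_def)
    then obtain u where u: "\<bar>u\<bar> \<le> pi" "\<zeta> = cis (\<theta> + u)" by (rule circle_angle_from)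
    have "cos (pi * q) < cos (\<theta> + u - \<theta>)"
      using \<zeta> unfolding circle_cap_def \<theta> u(2) Re_cis_mult_cnj_cis[symmetric] by simp
    then have "cos (pi * q) < cos \<bar>u\<bar>" by simp
    then have "\<bar>u\<bar> \<le> pi * q"
      using cos_monotone_0_pi_le[of "pi * q" "\<bar>u\<bar>"] u pq by linarith
    then show ?thesis using u by (intro image_eqI[of _ _ "\<theta> + u"]) auto
  qed
  ultimately show ?thesis
    unfolding is_circle_arc_def using \<theta> pq by (auto intro!: exI[of _ \<theta>])
qed

text \<open>Where the weight equals the threshold, the bathtub integrand vanishes whatever
  \<open>V\<close> is. This level set lies in the two points at angle \<open>pi * q\<close> on
  either side of \<open>e\<close>.\<close>

lemma AE_not_cap_boundary:
  assumes e: "norm e = 1" and q: "0 < q" "q < 1"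
  shows "AE \<zeta> in arc_length_measure. Re (\<zeta> * cnj e) \<noteq> cos (pi * q)"
proof -
  obtain \<theta> where \<theta>: "e = cis \<theta>" using e by (rule cis_surj_circle)
  show ?thesis
    using AE_space AE_arc_length_singleton[of "cis (\<theta> + pi * q)"]
      AE_arc_length_singleton[of "cis (\<theta> - pi * q)"]
  proof eventually_elim
    case (elim \<zeta>)
    then have "norm \<zeta> = 1" by simp
    then obtain u where u: "\<bar>u\<bar> \<le> pi" "\<zeta> = cis (\<theta> + u)" by (rule circle_angle_from)
    have "Re (\<zeta> * cnj e) = cos \<bar>u\<bar>"
      unfolding \<theta> u(2) Re_cis_mult_cnj_cis by simp
    moreover have "u \<noteq> pi * q" "u \<noteq> - (pi * q)"
      using elim u(2) by auto
    then have "\<bar>u\<bar> \<noteq> pi * q" by linarith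
    ultimately show ?case
      using cos_inj_pi[of "\<bar>u\<bar>" "pi * q"] u q by auto
  qed
qed

text \<open>The integrand \<open>(1\<^sub>C - V) (k - cos (\<pi> q))\<close>, with \<open>C\<close> the cap and \<open>k \<zeta> = Re (\<zeta> * cnj e)\<close>, is
  nonnegative, and vanishes off the two boundary points of the cap only where \<open>V = 1\<^sub>C\<close>.\<close>

lemma bathtub_cap:
  assumes e: "norm e = 1" and q: "0 < q" "q < 1"
    and V [measurable]: "V \<in> borel_measurable arc_length_measure"
    and V01: "AE \<zeta> in arc_length_measure. 0 \<le> V \<zeta> \<and> V \<zeta> \<le> (1::real)"
    and mass: "(\<integral>\<zeta>. V \<zeta> \<partial>arc_length_measure) = 2 * pi * q"
  shows "(\<integral>\<zeta>. V \<zeta> * Re (\<zeta> * cnj e) \<partial>arc_length_measure) \<le> 2 * sin (pi * q)" (is ?le)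
    and "(\<integral>\<zeta>. V \<zeta> * Re (\<zeta> * cnj e) \<partial>arc_length_measure) = 2 * sin (pi * q) \<Longrightarrow>
      AE \<zeta> in arc_length_measure. V \<zeta> = indicator (circle_cap e q) \<zeta>"
proof -
  define C where "C = circle_cap e q"
  define k where "k \<zeta> = Re (\<zeta> * cnj e)" for \<zeta>
  define c where "c = cos (pi * q)"
  have arc: "is_circle_arc C e (2 * pi * q)"
    unfolding C_def by (rule is_circle_arc_cap[OF e q])
  have [measurable]: "C \<in> sets arc_length_measure"
    by (rule is_circle_arc_sets[OF arc])
  have [measurable]: "k \<in> borel_measurable arc_length_measure"
    unfolding k_def by (intro continuous_on_circle_measurable continuous_intros)
  have k1: "\<bar>k \<zeta>\<bar> \<le> 1" if "\<zeta> \<in> unit_circle" for \<zeta>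
    using that e abs_Re_le_cmod[of "\<zeta> * cnj e"] by (simp add: k_def norm_mult)
  have Vk: "integrable arc_length_measure (\<lambda>\<zeta>. V \<zeta> * k \<zeta>)"
  proof (rule integrable_arc_length_bounded[where B = 1])
    show "AE \<zeta> in arc_length_measure. norm (V \<zeta> * k \<zeta>) \<le> 1"
      using V01 AE_space by eventually_elim (use k1 in \<open>auto simp: abs_mult intro!: mult_le_one\<close>)
  qed measurable
  have iV: "integrable arc_length_measure V"
    by (rule integrable_arc_length_bounded[where B = 1]) (use V01 in auto)
  have i1: "integrable arc_length_measure (indicator C :: complex \<Rightarrow> real)"
    by (rule integrable_arc_length_bounded[where B = 1]) (auto simp: indicator_def)
  have ik: "integrable arc_length_measure (\<lambda>\<zeta>. k \<zeta> * indicator C \<zeta>)"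
    by (rule integrable_arc_length_bounded[where B = 1])
       (use k1 in \<open>auto simp: indicator_def intro!: AE_I2\<close>)
  define g where "g \<zeta> = (indicator C \<zeta> - V \<zeta>) * (k \<zeta> - c)" for \<zeta>
  have g_eq: "g = (\<lambda>\<zeta>. k \<zeta> * indicator C \<zeta> - V \<zeta> * k \<zeta> - c * (indicator C \<zeta> - V \<zeta>))"
    by (auto simp: g_def algebra_simps)
  have ig: "integrable arc_length_measure g"
    unfolding g_eq by (intro Bochner_Integration.integrable_diff integrable_mult_right ik Vk i1 iV)
  \<comment> \<open>The threshold term integrates to zero since \<open>V\<close> and the cap have
    the same mass; only the difference of the first moments remains.\<close>
  have "integral\<^sup>L arc_length_measure g
      = 2 * sin (pi * q) - (\<integral>\<zeta>. V \<zeta> * k \<zeta> \<partial>arc_length_measure)"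
    using integral_circle_arc[OF arc] mass ik Vk i1 iV
    unfolding g_eq k_def by simp
  moreover have g0: "AE \<zeta> in arc_length_measure. 0 \<le> g \<zeta>"
    using V01 AE_space
  proof eventually_elim
    case (elim \<zeta>)
    then show ?case
    proof (cases "\<zeta> \<in> C")
      case True
      then have "0 \<le> k \<zeta> - c" by (simp add: C_def circle_cap_def k_def c_def)
      with True elim show ?thesis by (auto simp: g_def)
    next
      case False
      then have "k \<zeta> - c \<le> 0"
        using elim by (simp add: C_def circle_cap_def k_def c_def not_less)
      with False elim show ?thesis by (auto simp: g_def intro: mult_nonneg_nonpos)
    qed
  qed
  ultimately have g_int: "0 \<le> 2 * sin (pi * q) - (\<integral>\<zeta>. V \<zeta> * k \<zeta> \<partial>arc_length_measure)"
    "integral\<^sup>L arc_length_measure g = 2 * sin (pi * q) - (\<integral>\<zeta>. V \<zeta> * k \<zeta> \<partial>arc_length_measure)"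
    using integral_nonneg_AE[OF g0] by auto
  then show ?le by (simp add: k_def)
  assume "(\<integral>\<zeta>. V \<zeta> * Re (\<zeta> * cnj e) \<partial>arc_length_measure) = 2 * sin (pi * q)"
  then have "integral\<^sup>L arc_length_measure g = 0"
    using g_int by (simp add: k_def)
  then have "AE \<zeta> in arc_length_measure. g \<zeta> = 0"
    using integral_nonneg_eq_0_iff_AE[OF ig g0] by simp
  then show "AE \<zeta> in arc_length_measure. V \<zeta> = indicator (circle_cap e q) \<zeta>"
    using AE_not_cap_boundary[OF e q]
    by eventually_elim (auto simp: g_def k_def c_def C_def)
qed

section \<open>Radial limits and the extremal problem for one component\<close>

text \<open>\<open>U\<close> comes without measurability, so \<open>V\<close> replaces it: the limit
  of \<open>f\<close> along a sequence of radii, equal to \<open>U\<close> almost everywhere. The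
  bounds on \<open>f\<close> give a dominating function, and the means over the circles of radius
  \<open>r n\<close> pass to the limit.\<close>

lemma boundary_values_means:
  assumes f: "harmonic_on f unit_disc" and bd: "\<And>z. z \<in> unit_disc \<Longrightarrow> \<alpha> \<le> f z \<and> f z \<le> \<beta>"
    and U: "radial_boundary_values f U"
    and D: "(f has_derivative D) (at 0)"
  obtains V where "V \<in> borel_measurable arc_length_measure"
    and "AE \<zeta> in arc_length_measure. U \<zeta> = V \<zeta> \<and> \<alpha> \<le> V \<zeta> \<and> V \<zeta> \<le> \<beta>"
    and "(\<integral>\<zeta>. V \<zeta> \<partial>arc_length_measure) = 2 * pi * f 0"
    and "\<And>e. (\<integral>\<zeta>. V \<zeta> * Re (\<zeta> * cnj e) \<partial>arc_length_measure) = pi * D e"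
proof -
  \<comment> \<open>The double successor keeps every radius positive; the sequence starts at
    \<open>1 / 2\<close>.\<close>
  define r where "r n = 1 - inverse (real (Suc (Suc n)))" for n
  have r: "0 < r n" "r n < 1" for n
    by (auto simp: r_def field_simps)
  have r1: "r \<longlonglongrightarrow> 1"
    using tendsto_diff[OF tendsto_const[of 1] LIMSEQ_Suc[OF LIMSEQ_inverse_real_of_nat]]
    by (simp add: r_def[abs_def])
  have rl: "filterlim r (at_left 1) sequentially"
    unfolding filterlim_at using r r1 by (auto intro!: always_eventually simp: less_imp_neq)
  define s where "s n \<zeta> = f (of_real (r n) * \<zeta>)" for n \<zeta>
  have cf: "continuous_on unit_disc f"
    using f unfolding harmonic_on_def
    by (auto intro!: continuous_at_imp_continuous_on dest: has_derivative_continuous)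
  have in_disc: "of_real (r n) * \<zeta> \<in> unit_disc" if "\<zeta> \<in> unit_circle" for n \<zeta>
    using that r[of n] by (simp add: norm_mult)
  have cs: "continuous_on unit_circle (s n)" for n
    unfolding s_def using in_disc
    by (intro continuous_on_compose2[OF cf] continuous_intros) auto
  have [measurable]: "s n \<in> borel_measurable arc_length_measure" for n
    by (rule continuous_on_circle_measurable[OF cs])
  \<comment> \<open>\<open>lim\<close> is total, so \<open>V\<close> is defined and measurable on
    the whole circle; its unspecified values at points of divergence lie in the null set where the
    radial limit fails.\<close>
  define V where "V \<zeta> = lim (\<lambda>n. s n \<zeta>)" for \<zeta>
  have V [measurable]: "V \<in> borel_measurable arc_length_measure"
    unfolding V_def by measurable
  have sV: "AE \<zeta> in arc_length_measure. U \<zeta> = V \<zeta> \<and> (\<lambda>n. s n \<zeta>) \<longlonglongrightarrow> V \<zeta>"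
    using U[unfolded radial_boundary_values_def]
  proof eventually_elim
    case (elim \<zeta>)
    have "(\<lambda>n. s n \<zeta>) \<longlonglongrightarrow> U \<zeta>"
      unfolding s_def by (rule filterlim_compose[OF elim rl])
    then show ?case
      using limI[of "\<lambda>n. s n \<zeta>" "U \<zeta>"] by (simp add: V_def)
  qed
  have sbd: "\<alpha> \<le> s n \<zeta> \<and> s n \<zeta> \<le> \<beta>" if "\<zeta> \<in> unit_circle" for n \<zeta>
    unfolding s_def using in_disc[OF that] by (rule bd)
  have lim: "(\<lambda>n. \<integral>\<zeta>. s n \<zeta> * w \<zeta> \<partial>arc_length_measure) \<longlonglongrightarrow> (\<integral>\<zeta>. V \<zeta> * w \<zeta> \<partial>arc_length_measure)"
    if w: "continuous_on unit_circle w" for w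
  proof (rule integral_dominated_convergence)
    note [measurable] = continuous_on_circle_measurable[OF w]
    show "(\<lambda>\<zeta>. V \<zeta> * w \<zeta>) \<in> borel_measurable arc_length_measure"
      "(\<lambda>\<zeta>. s n \<zeta> * w \<zeta>) \<in> borel_measurable arc_length_measure" for n
      by measurable
    show "integrable arc_length_measure (\<lambda>\<zeta>. (\<bar>\<alpha>\<bar> + \<bar>\<beta>\<bar>) * \<bar>w \<zeta>\<bar>)"
      by (intro integrable_arc_length_continuous continuous_intros w)
    show "AE \<zeta> in arc_length_measure. (\<lambda>n. s n \<zeta> * w \<zeta>) \<longlonglongrightarrow> V \<zeta> * w \<zeta>"
      using sV by eventually_elim (auto intro!: tendsto_intros)
    show "AE \<zeta> in arc_length_measure. norm (s n \<zeta> * w \<zeta>) \<le> (\<bar>\<alpha>\<bar> + \<bar>\<beta>\<bar>) * \<bar>w \<zeta>\<bar>" for n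
    proof (rule AE_I2)
      fix \<zeta> assume "\<zeta> \<in> space arc_length_measure"
      then have "\<bar>s n \<zeta>\<bar> \<le> \<bar>\<alpha>\<bar> + \<bar>\<beta>\<bar>"
        using sbd[of \<zeta> n] by auto
      then show "norm (s n \<zeta> * w \<zeta>) \<le> (\<bar>\<alpha>\<bar> + \<bar>\<beta>\<bar>) * \<bar>w \<zeta>\<bar>"
        by (simp add: abs_mult mult_right_mono)
    qed
  qed
  show ?thesis
  proof (rule that[OF V])
    show "AE \<zeta> in arc_length_measure. U \<zeta> = V \<zeta> \<and> \<alpha> \<le> V \<zeta> \<and> V \<zeta> \<le> \<beta>"
      using sV AE_space
    proof eventually_elim
      case (elim \<zeta>)
      then have "\<zeta> \<in> unit_circle" by simp
      then show ?case
        using elim LIMSEQ_le_const[of "\<lambda>n. s n \<zeta>" "V \<zeta>" \<alpha>] LIMSEQ_le_const2[of "\<lambda>n. s n \<zeta>" "V \<zeta>" \<beta>]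
          sbd by blast
    qed
    show "(\<integral>\<zeta>. V \<zeta> \<partial>arc_length_measure) = 2 * pi * f 0"
      using lim[of "\<lambda>_. 1"] harmonic_circle_means(1)[OF f r D]
      by (simp add: s_def LIMSEQ_const_iff)
    show "(\<integral>\<zeta>. V \<zeta> * Re (\<zeta> * cnj e) \<partial>arc_length_measure) = pi * D e" for e
    proof (rule LIMSEQ_unique)
      show "(\<lambda>n. pi * r n * D e) \<longlonglongrightarrow> (\<integral>\<zeta>. V \<zeta> * Re (\<zeta> * cnj e) \<partial>arc_length_measure)"
        using lim[of "\<lambda>\<zeta>. Re (\<zeta> * cnj e)"] harmonic_circle_means(2)[OF f r D]
        by (simp add: s_def continuous_intros del: times_complex.sel)
      show "(\<lambda>n. pi * r n * D e) \<longlonglongrightarrow> pi * D e"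
        using tendsto_mult[OF tendsto_mult[OF tendsto_const[of pi] r1] tendsto_const[of "D e"]] by simp
    qed
  qed
qed

text \<open>Rescaling the boundary values to \<open>W\<close>, with values in \<open>[0, 1]\<close>,
  gives mass \<open>2 * pi * q\<close>. A constant has no first moment, so that of \<open>W\<close>
  is \<open>pi * D e / (\<beta> - \<alpha>)\<close>, and both claims are those of
  \<open>bathtub_cap\<close>. The strict bounds on \<open>f\<close> at 0 put \<open>q\<close>
  strictly between 0 and 1.\<close>

lemma gradient_extremal:
  assumes f: "harmonic_on f unit_disc" and bd: "\<And>z. z \<in> unit_disc \<Longrightarrow> \<alpha> < f z \<and> f z < \<beta>"
    and U: "radial_boundary_values f U"
    and D: "(f has_derivative D) (at 0)" and e: "norm e = 1"
    and q: "q = (f 0 - \<alpha>) / (\<beta> - \<alpha>)"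
  shows "D e \<le> A_coef \<alpha> \<beta> (f 0)"
    and "D e = A_coef \<alpha> \<beta> (f 0) \<Longrightarrow>
      AE \<zeta> in arc_length_measure. (U \<zeta> - \<alpha>) / (\<beta> - \<alpha>) = indicator (circle_cap e q) \<zeta>"
proof -
  have ab: "\<alpha> < f 0" "f 0 < \<beta>" using bd[of 0] by auto
  then have q01: "0 < q" "q < 1" by (auto simp: q field_simps)
  have bd': "\<alpha> \<le> f z \<and> f z \<le> \<beta>" if "z \<in> unit_disc" for z
    using bd[OF that] by simp
  obtain V where V [measurable]: "V \<in> borel_measurable arc_length_measure"
    and UV: "AE \<zeta> in arc_length_measure. U \<zeta> = V \<zeta> \<and> \<alpha> \<le> V \<zeta> \<and> V \<zeta> \<le> \<beta>"
    and V0: "(\<integral>\<zeta>. V \<zeta> \<partial>arc_length_measure) = 2 * pi * f 0"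
    and V1: "\<And>e. (\<integral>\<zeta>. V \<zeta> * Re (\<zeta> * cnj e) \<partial>arc_length_measure) = pi * D e"
    using boundary_values_means[OF f bd' U D] by blast
  define W where "W \<zeta> = (V \<zeta> - \<alpha>) / (\<beta> - \<alpha>)" for \<zeta>
  have W [measurable]: "W \<in> borel_measurable arc_length_measure"
    unfolding W_def by measurable
  have W01: "AE \<zeta> in arc_length_measure. 0 \<le> W \<zeta> \<and> W \<zeta> \<le> 1"
    using UV by eventually_elim (use ab in \<open>auto simp: W_def field_simps\<close>)
  have iV: "integrable arc_length_measure V"
  proof (rule integrable_arc_length_bounded[where B = "\<bar>\<alpha>\<bar> + \<bar>\<beta>\<bar>"])
    show "AE \<zeta> in arc_length_measure. norm (V \<zeta>) \<le> \<bar>\<alpha>\<bar> + \<bar>\<beta>\<bar>"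
      using UV by eventually_elim auto
  qed measurable
  have ik: "integrable arc_length_measure (\<lambda>\<zeta>. Re (\<zeta> * cnj e))"
    by (intro integrable_arc_length_continuous continuous_intros)
  have [measurable]: "(\<lambda>\<zeta>. Re (\<zeta> * cnj e)) \<in> borel_measurable arc_length_measure"
    using ik by (rule borel_measurable_integrable)
  have iVk: "integrable arc_length_measure (\<lambda>\<zeta>. V \<zeta> * Re (\<zeta> * cnj e))"
  proof (rule integrable_arc_length_bounded[where B = "\<bar>\<alpha>\<bar> + \<bar>\<beta>\<bar>"])
    show "AE \<zeta> in arc_length_measure. norm (V \<zeta> * Re (\<zeta> * cnj e)) \<le> \<bar>\<alpha>\<bar> + \<bar>\<beta>\<bar>"
      using UV AE_space
    proof eventually_elim
      case (elim \<zeta>)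
      have "\<bar>V \<zeta>\<bar> \<le> \<bar>\<alpha>\<bar> + \<bar>\<beta>\<bar>" using elim by linarith
      moreover have "\<bar>Re (\<zeta> * cnj e)\<bar> \<le> 1"
        using elim e abs_Re_le_cmod[of "\<zeta> * cnj e"] by (simp add: norm_mult)
      ultimately have "\<bar>V \<zeta>\<bar> * \<bar>Re (\<zeta> * cnj e)\<bar> \<le> (\<bar>\<alpha>\<bar> + \<bar>\<beta>\<bar>) * 1"
        by (intro mult_mono) auto
      then show ?case by (simp add: abs_mult del: times_complex.sel)
    qed
  qed measurable
  have "(\<integral>\<zeta>. W \<zeta> \<partial>arc_length_measure) = (2 * pi * f 0 - 2 * pi * \<alpha>) / (\<beta> - \<alpha>)"
    unfolding W_def integral_divide_zero
    by (subst Bochner_Integration.integral_diff[OF iV integrable_arc_length_continuous])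
       (simp_all only: V0 integral_circle_const continuous_on_const)
  also have "\<dots> = 2 * pi * q"
    by (simp add: q diff_divide_distrib algebra_simps)
  finally have mass: "(\<integral>\<zeta>. W \<zeta> \<partial>arc_length_measure) = 2 * pi * q" .
  have "(\<integral>\<zeta>. W \<zeta> * Re (\<zeta> * cnj e) \<partial>arc_length_measure)
      = (\<integral>\<zeta>. (V \<zeta> * Re (\<zeta> * cnj e) - \<alpha> * Re (\<zeta> * cnj e)) / (\<beta> - \<alpha>) \<partial>arc_length_measure)"
    by (intro Bochner_Integration.integral_cong) (simp_all add: W_def left_diff_distrib del: times_complex.sel)
  also have "\<dots> = (\<integral>\<zeta>. V \<zeta> * Re (\<zeta> * cnj e) - \<alpha> * Re (\<zeta> * cnj e) \<partial>arc_length_measure) / (\<beta> - \<alpha>)"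
    by (rule integral_divide_zero)
  also have "\<dots> = pi * D e / (\<beta> - \<alpha>)"
    by (subst Bochner_Integration.integral_diff[OF iVk integrable_mult_right[OF ik]])
       (simp add: V1 integral_circle_direction del: times_complex.sel)
  finally have first: "(\<integral>\<zeta>. W \<zeta> * Re (\<zeta> * cnj e) \<partial>arc_length_measure) = pi * D e / (\<beta> - \<alpha>)" .
  have A: "A_coef \<alpha> \<beta> (f 0) = (\<beta> - \<alpha>) / pi * (2 * sin (pi * q))"
    by (simp add: A_coef_def q)
  note bt = bathtub_cap[OF e q01 W W01 mass, unfolded first]
  show "D e \<le> A_coef \<alpha> \<beta> (f 0)"
    using bt(1) ab by (simp add: A field_simps)
  assume "D e = A_coef \<alpha> \<beta> (f 0)"
  then have "pi * D e / (\<beta> - \<alpha>) = 2 * sin (pi * q)"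
    using ab by (simp add: A)
  from bt(2)[OF this] UV
  show "AE \<zeta> in arc_length_measure. (U \<zeta> - \<alpha>) / (\<beta> - \<alpha>) = indicator (circle_cap e q) \<zeta>"
    by eventually_elim (auto simp: W_def)
qed

section \<open>Poisson integrals of arcs\<close>

text \<open>An antiderivative in the angle of the Poisson kernel
  \<open>1 + 2 * Re (w + w\<^sup>2 + ...)\<close> with \<open>w = z * cis (- t)\<close>; integrating
  the series termwise produces the logarithm. Since \<open>1 - w\<close> has positive real part, the
  principal branch is smooth for all real \<open>t\<close>, and one formula covers every
  arc.\<close>

definition poisson_primitive :: "complex \<Rightarrow> real \<Rightarrow> real" where
  "poisson_primitive z t = t + 2 * Im (Ln (1 - z * cis (- t)))"

lemma one_minus_cis_pos:
  assumes "norm z < 1"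
  shows "0 < Re (1 - z * cis t)"
  using complex_Re_le_cmod[of "z * cis t"] assms by (simp add: norm_mult)

lemma one_minus_cis_not_nonpos:
  assumes "norm z < 1"
  shows "1 - z * cis t \<notin> \<real>\<^sub>\<le>\<^sub>0"
  using one_minus_cis_pos[OF assms, of t] by (auto simp: complex_nonpos_Reals_iff simp del: minus_complex.sel)

text \<open>With \<open>w = z * cis (- t)\<close> the derivative is \<open>1 + 2 Re (w / (1 - w)) = Re ((1 + w) / (1 - w))\<close>.\<close>

lemma poisson_primitive_deriv:
  assumes z: "norm z < 1"
  shows "(poisson_primitive z has_real_derivative (1 - (norm z)\<^sup>2) / (norm (cis t - z))\<^sup>2) (at t)"
proof -
  define w where "w = z * cis (- t)"
  have w1: "1 - w \<noteq> 0"
    using one_minus_cis_pos[OF z, of "- t"] unfolding w_def by (metis less_irrefl zero_complex.sel(1))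
  have "((\<lambda>t. exp (- (\<i> * of_real t))) has_vector_derivative (- \<i> * exp (- (\<i> * of_real t)))) (at t)"
    by (rule has_vector_derivative_real_field) (auto intro!: derivative_eq_intros)
  then have "((\<lambda>t. cis (- t)) has_vector_derivative (- \<i> * cis (- t))) (at t)"
    by (simp add: cis_conv_exp)
  then have "((\<lambda>t. 1 - z * cis (- t)) has_vector_derivative (0 - z * (- \<i> * cis (- t)))) (at t)"
    by (intro has_vector_derivative_diff has_vector_derivative_const has_vector_derivative_mult_right)
  from field_vector_diff_chain_at[OF this has_field_derivative_Ln[OF one_minus_cis_not_nonpos[OF z]]]
  have "((\<lambda>t. Ln (1 - z * cis (- t))) has_vector_derivative (\<i> * w / (1 - w))) (at t)"
    by (simp add: o_def w_def field_simps)
  then have "((\<lambda>t. Im (Ln (1 - z * cis (- t)))) has_vector_derivative Im (\<i> * w / (1 - w))) (at t)"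
    by (rule bounded_linear.has_vector_derivative[OF bounded_linear_Im])
  then have "((\<lambda>t. Im (Ln (1 - z * cis (- t)))) has_real_derivative Im (\<i> * w / (1 - w))) (at t)"
    by (simp only: has_real_derivative_iff_has_vector_derivative)
  then have "(poisson_primitive z has_real_derivative (1 + 2 * Im (\<i> * w / (1 - w)))) (at t)"
    unfolding poisson_primitive_def[abs_def] by (intro DERIV_add DERIV_ident DERIV_cmult)
  moreover have "1 + 2 * Im (\<i> * w / (1 - w)) = (1 - (norm z)\<^sup>2) / (norm (cis t - z))\<^sup>2"
  proof -
    have "cis t - z = cis t * (1 - w)"
      by (simp add: w_def algebra_simps cis_mult)
    then have "norm (cis t - z) = norm (1 - w)" by (simp add: norm_mult)
    moreover have "norm z = norm w" by (simp add: w_def norm_mult)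
    moreover have "Im (\<i> * w / (1 - w)) = Re (w / (1 - w))"
      by (metis Im_i_times times_divide_eq_right)
    moreover have "Re (w / (1 - w)) = Re (w * cnj (1 - w)) / (norm (1 - w))\<^sup>2"
      by (subst complex_div_cnj) (simp add: Re_divide_of_real)
    moreover have "(norm (1 - w))\<^sup>2 + 2 * Re (w * cnj (1 - w)) = 1 - (norm w)\<^sup>2"
      unfolding cmod_power2 by (simp add: power2_eq_square algebra_simps)
    ultimately show ?thesis
      using w1 by (simp add: field_simps)
  qed
  ultimately show ?thesis by simp
qed

text \<open>The Poisson kernel is positive. Together with the increment \<open>2 * pi\<close> over a
  period, this keeps the Poisson integral of a proper arc strictly between 0 and 1, hence the map
  inside the open box.\<close>

lemma poisson_primitive_strict_mono:
  assumes "norm z < 1" "s < t"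
  shows "poisson_primitive z s < poisson_primitive z t"
proof (rule DERIV_pos_imp_increasing[OF assms(2)])
  fix x
  have "(norm z)\<^sup>2 < 1" "norm (cis x - z) \<noteq> 0"
    using assms(1) by (auto simp: power_less_one_iff abs_square_less_1)
  then have "(1 - (norm z)\<^sup>2) / (norm (cis x - z))\<^sup>2 > 0"
    by (intro divide_pos_pos) (auto simp: zero_less_power2)
  then show "\<exists>y. (poisson_primitive z has_real_derivative y) (at x) \<and> 0 < y"
    using poisson_primitive_deriv[OF assms(1)] by blast
qed

lemma poisson_primitive_period: "poisson_primitive z (t + 2 * pi) = poisson_primitive z t + 2 * pi"
proof -
  have "cis (- (t + 2 * pi)) = cis (- t)"
    by (simp add: complex_eq_iff sin_diff cos_diff)
  then show ?thesis by (simp add: poisson_primitive_def)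
qed

lemma poisson_integral_arc:
  assumes I: "cis ` {\<alpha><..<\<beta>} \<subseteq> I" "I \<subseteq> cis ` {\<alpha>..\<beta>}" and le: "\<alpha> \<le> \<beta>" "\<beta> \<le> \<alpha> + 2 * pi"
    and U: "\<And>\<zeta>. \<zeta> \<in> unit_circle \<Longrightarrow> U \<zeta> = a + d * indicator I \<zeta>"
    and z: "norm z < 1"
  shows "poisson_integral U z = a + d * ((poisson_primitive z \<beta> - poisson_primitive z \<alpha>) / (2 * pi))"
proof -
  define P where "P \<zeta> = (1 - (norm z)\<^sup>2) / (norm (\<zeta> - z))\<^sup>2" for \<zeta>
  have P: "continuous_on unit_circle P"
    unfolding P_def using z by (intro continuous_intros) auto
  note [measurable] = continuous_on_circle_measurable[OF P]
  have deriv: "(poisson_primitive z has_real_derivative P (cis t)) (at t)" for t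
    unfolding P_def by (rule poisson_primitive_deriv[OF z])
  have P1: "(\<integral>\<zeta>. P \<zeta> \<partial>arc_length_measure) = 2 * pi"
    using integral_circle_FTC[OF P deriv] poisson_primitive_period[of z 0] by simp
  have PI: "(\<integral>\<zeta>. P \<zeta> * indicator I \<zeta> \<partial>arc_length_measure) = poisson_primitive z \<beta> - poisson_primitive z \<alpha>"
    by (rule integral_arc_FTC[OF I le P deriv])
  have iP: "integrable arc_length_measure P"
    by (rule integrable_arc_length_continuous[OF P])
  have "I \<in> sets arc_length_measure"
    using arc_borel[OF I] sets_arc_length_measure by blast
  then have iPI: "integrable arc_length_measure (\<lambda>\<zeta>. P \<zeta> * indicator I \<zeta>)"
    by (rule integrable_real_mult_indicator[OF _ iP])
  have "(\<integral>\<zeta>. P \<zeta> * U \<zeta> \<partial>arc_length_measure)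
      = (\<integral>\<zeta>. a * P \<zeta> + d * (P \<zeta> * indicator I \<zeta>) \<partial>arc_length_measure)"
    by (intro Bochner_Integration.integral_cong) (auto simp: U algebra_simps)
  also have "\<dots> = a * (2 * pi) + d * (poisson_primitive z \<beta> - poisson_primitive z \<alpha>)"
    using iP iPI P1 PI by simp
  finally show ?thesis
    unfolding poisson_integral_def P_def[symmetric] by (simp add: field_simps)
qed

text \<open>The variable \<open>z\<close> enters \<open>poisson_primitive\<close> only through
  \<open>2 * Im (Ln (1 - z * cis (- t)))\<close>, the real part of
  \<open>- 2 * \<i> * Ln (1 - z * cis (- t))\<close>, which is holomorphic in \<open>z\<close>. So
  \<open>f\<close> is the real part of an explicit \<open>H\<close>, and its gradient at 0 is read
  off from \<open>H' 0\<close>.\<close>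

lemma poisson_integral_arc_harmonic:
  assumes arc: "is_circle_arc I c (2 * pi * q)" and ab: "a < b"
    and U: "\<And>\<zeta>. \<zeta> \<in> unit_circle \<Longrightarrow> U \<zeta> = a + (b - a) * indicator I \<zeta>"
    and f: "\<And>z. z \<in> unit_disc \<Longrightarrow> f z = poisson_integral U z"
  shows "harmonic_on f unit_disc"
    and "\<And>z. z \<in> unit_disc \<Longrightarrow> a < f z \<and> f z < b"
    and "f 0 = a + (b - a) * q"
    and "(f has_derivative (\<lambda>h. 2 * (b - a) / pi * sin (pi * q) * Re (h * cnj c))) (at 0)"
proof -
  obtain \<theta> where q: "0 < pi * q" "pi * q < pi" and \<theta>: "c = cis \<theta>"
    and I: "cis ` {\<theta> - pi * q <..< \<theta> + pi * q} \<subseteq> I" "I \<subseteq> cis ` {\<theta> - pi * q .. \<theta> + pi * q}"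
    using arc unfolding is_circle_arc_def by auto
  define \<alpha> where "\<alpha> = \<theta> - pi * q"
  define \<beta> where "\<beta> = \<theta> + pi * q"
  have fz: "f z = a + (b - a) * ((poisson_primitive z \<beta> - poisson_primitive z \<alpha>) / (2 * pi))"
    if "z \<in> unit_disc" for z
    unfolding \<alpha>_def \<beta>_def f[OF that] using q that
    by (intro poisson_integral_arc[OF I _ _ U]) auto
  show "a < f z \<and> f z < b" if z: "z \<in> unit_disc" for z
  proof -
    \<comment> \<open>The harmonic measure of the arc seen from \<open>z\<close>.\<close>
    define x where "x = (poisson_primitive z \<beta> - poisson_primitive z \<alpha>) / (2 * pi)"
    have "poisson_primitive z \<alpha> < poisson_primitive z \<beta>"
      "poisson_primitive z \<beta> < poisson_primitive z (\<alpha> + 2 * pi)"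
      using z q by (intro poisson_primitive_strict_mono; simp add: \<alpha>_def \<beta>_def)+
    then have "0 < x" "x < 1"
      by (simp_all add: x_def poisson_primitive_period)
    then have "0 < (b - a) * x" "(b - a) * x < (b - a) * 1"
      using ab by (auto intro!: mult_strict_left_mono)
    then show ?thesis using fz[OF z] by (simp add: x_def)
  qed
  show "f 0 = a + (b - a) * q"
    using fz[of 0] by (simp add: poisson_primitive_def \<alpha>_def \<beta>_def)
  define H where "H z = of_real a + of_real (b - a) / (2 * of_real pi) *
    (of_real (\<beta> - \<alpha>) - 2 * \<i> * (Ln (1 - z * cis (- \<beta>)) - Ln (1 - z * cis (- \<alpha>))))" for z
  define H' where "H' z = of_real (b - a) / (2 * of_real pi) *
    (- 2 * \<i> * (- cis (- \<beta>) / (1 - z * cis (- \<beta>)) - - cis (- \<alpha>) / (1 - z * cis (- \<alpha>))))" for z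
  have HD: "(H has_field_derivative H' z) (at z)" if "z \<in> unit_disc" for z
  proof -
    have ln: "((\<lambda>z. Ln (1 - z * cis t)) has_field_derivative - cis t / (1 - z * cis t)) (at z)" for t
      using one_minus_cis_not_nonpos[of z t] that
      by (auto intro!: derivative_eq_intros simp: field_simps)
    have "((\<lambda>z. of_real a + of_real (b - a) / (2 * of_real pi) *
      (of_real (\<beta> - \<alpha>) - 2 * \<i> * (Ln (1 - z * cis (- \<beta>)) - Ln (1 - z * cis (- \<alpha>)))))
      has_field_derivative (0 + of_real (b - a) / (2 * of_real pi) *
      (0 - 2 * \<i> * (- cis (- \<beta>) / (1 - z * cis (- \<beta>)) - - cis (- \<alpha>) / (1 - z * cis (- \<alpha>)))))) (at z)"
      by (intro DERIV_add DERIV_const DERIV_cmult DERIV_diff ln)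
    then show ?thesis
      unfolding H_def H'_def by simp
  qed
  have fH: "f z = Re (H z)" if "z \<in> unit_disc" for z
  proof -
    have H_eq: "H z = of_real a + of_real ((b - a) / (2 * pi)) *
      (of_real (\<beta> - \<alpha>) - 2 * \<i> * (Ln (1 - z * cis (- \<beta>)) - Ln (1 - z * cis (- \<alpha>))))"
      by (simp add: H_def)
    show ?thesis
      unfolding fz[OF that] poisson_primitive_def H_eq by (simp add: field_simps)
  qed
  show "harmonic_on f unit_disc"
    by (rule harmonic_on_Re[OF open_ball HD fH])
  have "((\<lambda>z. Re (H z)) has_derivative (\<lambda>h. Re (H' 0 * h))) (at 0)"
    using HD[of 0] by (intro has_derivative_Re) (simp add: has_field_derivative_def)
  then have "(f has_derivative (\<lambda>h. Re (H' 0 * h))) (at 0)"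
    by (rule has_derivative_transform_within_open[OF _ open_ball[of 0 1]]) (simp_all add: fH)
  moreover have "H' 0 = of_real (2 * (b - a) / pi * sin (pi * q)) * cnj c"
  proof -
    \<comment> \<open>At 0 the derivative of \<open>H\<close> reduces to a multiple of the chord
      joining the conjugate end points. This chord is perpendicular to the bisecting direction
      \<open>cnj c\<close> and has length \<open>2 * sin (pi * q)\<close>.\<close>
    have "cis (- \<beta>) - cis (- \<alpha>) = - 2 * \<i> * of_real (sin (pi * q)) * cnj c"
      by (simp add: complex_eq_iff \<theta> \<alpha>_def \<beta>_def cos_diff sin_diff cos_add sin_add)
    moreover have "H' 0 = of_real (b - a) / (2 * of_real pi) * (2 * \<i> * (cis (- \<beta>) - cis (- \<alpha>)))"
      unfolding H'_def by (simp add: right_diff_distrib)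
    ultimately have "H' 0 = of_real (b - a) / (2 * of_real pi) * (2 * \<i> * (- 2 * \<i> * of_real (sin (pi * q)) * cnj c))"
      by simp
    also have "\<dots> = of_real (2 * (b - a) / pi * sin (pi * q)) * cnj c"
      by (simp add: field_simps)
    finally show ?thesis .
  qed
  moreover have "Re (of_real r * cnj c * h) = r * Re (h * cnj c)" for r h
    by (simp add: algebra_simps)
  ultimately show "(f has_derivative (\<lambda>h. 2 * (b - a) / pi * sin (pi * q) * Re (h * cnj c))) (at 0)"
    by simp
qed

section \<open>Derivatives of vector valued maps and operator norms\<close>

lemma has_derivative_vec_components:
  fixes F :: "'a::real_normed_vector \<Rightarrow> real ^ 'n"
  assumes "\<And>j. ((\<lambda>z. F z $ j) has_derivative D j) (at x)"
  shows "(F has_derivative (\<lambda>h. \<chi> j. D j h)) (at x)"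
  using assms
  by (subst has_derivative_componentwise_within) (auto simp: Basis_vec_def inner_axis)

lemma onorm_eqI:
  assumes "bounded_linear f" and "\<And>x. norm (f x) \<le> b * norm x" and "norm e = 1" "norm (f e) = b"
  shows "onorm f = b"
proof (rule antisym)
  show "onorm f \<le> b"
    using assms(2) assms(4) norm_ge_zero by (intro onorm_bound) auto
  show "b \<le> onorm f"
    using onorm[OF assms(1), of e] assms(3,4) by simp
qed

text \<open>Compactness of the unit circle yields the direction in which the equality case is
  tested; homogeneity extends the maximum from the circle to all vectors.\<close>

lemma onorm_attained:
  fixes T :: "complex \<Rightarrow> 'b::real_normed_vector"
  assumes "bounded_linear T"
  obtains e where "norm e = 1" "norm (T e) = onorm T"
proof -
  interpret bounded_linear T by fact
  have "continuous_on (sphere 0 1) (\<lambda>x. norm (T x))"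
    by (intro continuous_intros linear_continuous_on assms)
  moreover have "sphere (0::complex) 1 \<noteq> {}" by (auto intro: exI[of _ 1])
  ultimately obtain e where e: "norm e = 1" and max: "\<And>x. norm x = 1 \<Longrightarrow> norm (T x) \<le> norm (T e)"
    using continuous_attains_sup[of "sphere 0 1" "\<lambda>x. norm (T x)"] by auto
  have "norm (T x) \<le> norm (T e) * norm x" for x
  proof (cases "x = 0")
    case False
    have "norm (T (x /\<^sub>R norm x)) \<le> norm (T e)"
      using False by (intro max) simp
    then show ?thesis
      using False by (simp add: scaleR field_simps)
  qed (simp add: zero)
  then have "onorm T = norm (T e)"
    using e by (intro onorm_eqI[OF assms, of _ e]) auto
  with e that show ?thesis by simp
qed

lemma norm_vec_real: "norm (x :: real ^ 'n) = sqrt (\<Sum>j\<in>UNIV. (x $ j)\<^sup>2)"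
  by (simp add: norm_vec_def L2_set_def)

section \<open>Combining the components\<close>

theorem proposition6p2:
  fixes a b p :: "real ^ 'n" and q :: "'n \<Rightarrow> real"
  assumes ab: "\<And>j. a $ j < b $ j"
    and p: "p \<in> box a b"
    and q: "\<And>j. q j = (p $ j - a $ j) / (b $ j - a $ j)"
  shows
    "(\<forall>(F :: complex \<Rightarrow> real ^ 'n) (U :: 'n \<Rightarrow> complex \<Rightarrow> real).
        harmonic_map_on F unit_disc \<and> F ` unit_disc \<subseteq> box a b \<and> F 0 = p \<and>
        onorm (frechet_derivative F (at 0)) = M_box a b p \<and>
        (\<forall>j. radial_boundary_values (\<lambda>z. F z $ j) (U j))
      \<longrightarrow>
        (\<exists>(I :: 'n \<Rightarrow> complex set) (c :: 'n \<Rightarrow> complex).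
           (\<forall>j. is_circle_arc (I j) (c j) (2 * pi * q j)) \<and>
           (\<forall>j. AE \<zeta> in arc_length_measure.
                  (U j \<zeta> - a $ j) / (b $ j - a $ j) = indicator (I j) \<zeta>) \<and>
           (\<forall>i j. c i = c j \<or> c i = - c j)))
     \<and>
     (\<forall>(I :: 'n \<Rightarrow> complex set) (c :: 'n \<Rightarrow> complex) (U :: 'n \<Rightarrow> complex \<Rightarrow> real)
        (F :: complex \<Rightarrow> real ^ 'n).
        (\<forall>j. is_circle_arc (I j) (c j) (2 * pi * q j)) \<and>
        (\<exists>u. u \<noteq> 0 \<and> (\<forall>j. c j \<in> span {u})) \<and>
        (\<forall>j. \<forall>\<zeta>\<in>unit_circle. U j \<zeta> = a $ j + (b $ j - a $ j) * indicator (I j) \<zeta>) \<and>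
        (\<forall>z\<in>unit_disc. \<forall>j. F z $ j = poisson_integral (U j) z)
      \<longrightarrow>
        harmonic_map_on F unit_disc \<and> F ` unit_disc \<subseteq> box a b \<and> F 0 = p \<and>
        onorm (frechet_derivative F (at 0)) = M_box a b p)"
proof (intro conjI allI impI)
  fix F :: "complex \<Rightarrow> real ^ 'n" and U :: "'n \<Rightarrow> complex \<Rightarrow> real"
  assume "harmonic_map_on F unit_disc \<and> F ` unit_disc \<subseteq> box a b \<and> F 0 = p \<and>
        onorm (frechet_derivative F (at 0)) = M_box a b p \<and>
        (\<forall>j. radial_boundary_values (\<lambda>z. F z $ j) (U j))"
  then have harm: "\<And>j. harmonic_on (\<lambda>z. F z $ j) unit_disc"
    and box: "F ` unit_disc \<subseteq> box a b" and F0: "F 0 = p"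
    and on: "onorm (frechet_derivative F (at 0)) = M_box a b p"
    and U: "\<And>j. radial_boundary_values (\<lambda>z. F z $ j) (U j)"
    by (auto simp: harmonic_map_on_def)
  have bd: "a $ j < F z $ j \<and> F z $ j < b $ j" if "z \<in> unit_disc" for z j
  proof -
    have "F z \<in> box a b" using box that by blast
    then show ?thesis by (simp add: mem_box_cart)
  qed
  have "\<exists>D. ((\<lambda>z. F z $ j) has_derivative D) (at 0)" for j
    using harm[of j] unfolding harmonic_on_def by (meson centre_in_ball zero_less_one)
  then obtain D where D: "\<And>j. ((\<lambda>z. F z $ j) has_derivative D j) (at 0)" by metis
  have FD: "(F has_derivative (\<lambda>h. \<chi> j. D j h)) (at 0)"
    by (rule has_derivative_vec_components[OF D])
  then have fr: "frechet_derivative F (at 0) = (\<lambda>h. \<chi> j. D j h)"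
    using frechet_derivative_at by metis
  obtain e where e: "norm e = 1" and eT: "norm (\<chi> j. D j e) = M_box a b p"
    using onorm_attained[OF has_derivative_bounded_linear[OF FD]] on fr by metis
  define A where "A j = A_coef (a $ j) (b $ j) (p $ j)" for j
  have q': "q j = (F 0 $ j - a $ j) / (b $ j - a $ j)" for j
    by (simp add: q F0)
  have ext: "D j x \<le> A j"
    "D j x = A j \<Longrightarrow> AE \<zeta> in arc_length_measure.
       (U j \<zeta> - a $ j) / (b $ j - a $ j) = indicator (circle_cap x (q j)) \<zeta>"
    if "norm x = 1" for j x
    unfolding A_def F0[symmetric]
    using gradient_extremal[OF harm bd U D that q'] by blast+
  \<comment> \<open>Oddness turns the upper bound \<open>ext(1)\<close>, applied at \<open>e\<close>
    and at \<open>- e\<close>, into a bound on the absolute value.\<close>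
  have Dm: "D j (- e) = - D j e" for j
    by (rule linear_neg[OF has_derivative_linear[OF D]])
  have le: "(D j e)\<^sup>2 \<le> (A j)\<^sup>2" for j
  proof (rule abs_le_square_iff[THEN iffD1])
    show "\<bar>D j e\<bar> \<le> \<bar>A j\<bar>"
      using ext(1)[of e j] ext(1)[of "- e" j] e Dm[of j] by simp
  qed
  have "(\<Sum>j\<in>UNIV. (D j e)\<^sup>2) = (\<Sum>j\<in>UNIV. (A j)\<^sup>2)"
    using eT by (simp add: norm_vec_real M_box_def A_def)
  then have "(\<Sum>j\<in>UNIV. (A j)\<^sup>2 - (D j e)\<^sup>2) = 0"
    by (simp add: sum_subtractf)
  \<comment> \<open>The differences are nonnegative and sum to zero, so each of them
    vanishes.\<close>
  then have sq: "(D j e)\<^sup>2 = (A j)\<^sup>2" for j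
    using le by (subst (asm) sum_nonneg_eq_0_iff) auto
  \<comment> \<open>Where \<open>D j e\<close> is negative, reversing the direction makes the upper
    bound attained, so the equality case of \<open>ext\<close> applies to every component.\<close>
  have "\<exists>c. (c = e \<or> c = - e) \<and> D j c = A j" for j
    using sq[of j] Dm[of j] by (auto simp: power2_eq_iff)
  then obtain c where c: "\<And>j. c j = e \<or> c j = - e" and cA: "\<And>j. D j (c j) = A j" by metis
  have nc: "norm (c j) = 1" for j
    using c[of j] e by auto
  have q01: "0 < q j" "q j < 1" for j
    using p ab[of j] by (auto simp: q mem_box_cart field_simps)
  show "\<exists>(I :: 'n \<Rightarrow> complex set) (c :: 'n \<Rightarrow> complex).
           (\<forall>j. is_circle_arc (I j) (c j) (2 * pi * q j)) \<and>
           (\<forall>j. AE \<zeta> in arc_length_measure.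
                  (U j \<zeta> - a $ j) / (b $ j - a $ j) = indicator (I j) \<zeta>) \<and>
           (\<forall>i j. c i = c j \<or> c i = - c j)"
  proof (intro exI[of _ "\<lambda>j. circle_cap (c j) (q j)"] exI[of _ c] conjI allI)
    show "is_circle_arc (circle_cap (c j) (q j)) (c j) (2 * pi * q j)" for j
      by (rule is_circle_arc_cap[OF nc q01])
    show "AE \<zeta> in arc_length_measure.
        (U j \<zeta> - a $ j) / (b $ j - a $ j) = indicator (circle_cap (c j) (q j)) \<zeta>" for j
      by (rule ext(2)[OF nc cA])
    show "c i = c j \<or> c i = - c j" for i j
      using c[of i] c[of j] by auto
  qed
next
  fix I :: "'n \<Rightarrow> complex set" and c :: "'n \<Rightarrow> complex" and U :: "'n \<Rightarrow> complex \<Rightarrow> real"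
    and F :: "complex \<Rightarrow> real ^ 'n"
  assume "(\<forall>j. is_circle_arc (I j) (c j) (2 * pi * q j)) \<and>
        (\<exists>u. u \<noteq> 0 \<and> (\<forall>j. c j \<in> span {u})) \<and>
        (\<forall>j. \<forall>\<zeta>\<in>unit_circle. U j \<zeta> = a $ j + (b $ j - a $ j) * indicator (I j) \<zeta>) \<and>
        (\<forall>z\<in>unit_disc. \<forall>j. F z $ j = poisson_integral (U j) z)"
  then obtain u where arc: "\<And>j. is_circle_arc (I j) (c j) (2 * pi * q j)"
    and u: "u \<noteq> 0" "\<And>j. c j \<in> span {u}"
    and U: "\<And>j \<zeta>. \<zeta> \<in> unit_circle \<Longrightarrow> U j \<zeta> = a $ j + (b $ j - a $ j) * indicator (I j) \<zeta>"
    and F: "\<And>j z. z \<in> unit_disc \<Longrightarrow> F z $ j = poisson_integral (U j) z"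
    by blast
  note comp = poisson_integral_arc_harmonic[OF arc ab U F]
  show "harmonic_map_on F unit_disc"
    unfolding harmonic_map_on_def using comp(1) by blast
  show "F ` unit_disc \<subseteq> box a b"
    using comp(2) by (auto simp: mem_box_cart)
  show "F 0 = p"
    using comp(3) ab by (simp add: vec_eq_iff q) (metis less_irrefl)
  define A where "A j = A_coef (a $ j) (b $ j) (p $ j)" for j
  define T where "T h = (\<chi> j. A j * Re (h * cnj (c j)))" for h
  have "((\<lambda>z. F z $ j) has_derivative (\<lambda>h. A j * Re (h * cnj (c j)))) (at 0)" for j
    using comp(4)[of j] by (simp add: A_def A_coef_def q)
  then have FT: "(F has_derivative T) (at 0)"
    unfolding T_def by (rule has_derivative_vec_components)
  then have fr: "frechet_derivative F (at 0) = T"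
    using frechet_derivative_at by metis
  \<comment> \<open>A unit vector on the common line; as the centers also have norm 1, each of them
    is \<open>e\<close> or \<open>- e\<close>.\<close>
  define e where "e = u /\<^sub>R norm u"
  have e: "norm e = 1" using u by (simp add: e_def)
  have ce: "c j = e \<or> c j = - e" for j
  proof -
    obtain k where k: "c j = k *\<^sub>R u"
      using u(2)[of j] by (auto simp: span_singleton)
    then have "\<bar>k\<bar> * norm u = 1"
      using is_circle_arc_norm[OF arc[of j]] by simp
    then have "k = inverse (norm u) \<or> k = - inverse (norm u)"
      using u(1) by (auto simp: field_simps abs_if split: if_splits)
    then show ?thesis using k by (auto simp: e_def)
  qed
  \<comment> \<open>The signs in \<open>c j = e\<close> or \<open>c j = - e\<close> disappear on
    squaring. All components of \<open>T h\<close> are then multiples of the same functional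
    \<open>Re (h * cnj e)\<close>, which is largest in absolute value on the unit circle at
    \<open>h = e\<close>.\<close>
  have nT: "norm (T h) = M_box a b p * \<bar>Re (h * cnj e)\<bar>" for h
  proof -
    have "(T h $ j)\<^sup>2 = (A j)\<^sup>2 * (Re (h * cnj e))\<^sup>2" for j
      using ce[of j] by (auto simp: T_def power_mult_distrib[symmetric] power2_eq_iff simp del: times_complex.sel)
    then have "norm (T h) = sqrt ((\<Sum>j\<in>UNIV. (A j)\<^sup>2) * (Re (h * cnj e))\<^sup>2)"
      by (simp add: norm_vec_real sum_distrib_right del: times_complex.sel)
    then show ?thesis
      by (simp add: M_box_def A_def real_sqrt_mult del: times_complex.sel)
  qed
  have M0: "0 \<le> M_box a b p"
    unfolding M_box_def by (intro real_sqrt_ge_zero sum_nonneg) simp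
  have "onorm T = M_box a b p"
  proof (rule onorm_eqI[OF has_derivative_bounded_linear[OF FT] _ e])
    show "norm (T h) \<le> M_box a b p * norm h" for h
      unfolding nT using abs_Re_le_cmod[of "h * cnj e"] e
      by (intro mult_left_mono M0) (simp add: norm_mult)
    have "e * cnj e = 1"
      using e by (metis complex_norm_square of_real_1 one_power2)
    then show "norm (T e) = M_box a b p"
      unfolding nT e by simp
  qed
  then show "onorm (frechet_derivative F (at 0)) = M_box a b p"
    by (simp only: fr)
qed

end
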